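(* Let $N\ge2$ and let $(S_i)_{i\in\mathbb{Z}_N}$, $(\tilde S_i)_{i\in\mathbb{Z}_N}$ be two purely atomic representations of the Cuntz algebra $\mathcal{O}_N$ on the Hilbert spaces $\mathcal{H}$, $\tilde{\mathcal{H}}$, with associated projection valued measures $P$ and $\tilde P$. The two representations are unitarily equivalent if and only if the following conditions are satisfied: (i) $\operatorname{supp}(P)=\operatorname{supp}(\tilde P)=:\Omega$; (ii) for every $\omega\in\Omega$, $\dim P(\omega)\mathcal{H}=\dim\tilde P(\omega)\tilde{\mathcal{H}}$; (iii) if $\omega\in\Omega$ is a cycle $\omega=\underline I$, then there exists a unitary map $U_\omega:P(\omega)\mathcal{H}\to\tilde P(\omega)\tilde{\mathcal{H}}$ such that $U_\omega S_I=\tilde S_IU_\omega$ on $P(\omega)\mathcal{H}$.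
   Context: $\mathbb{Z}_N=\{0,1,\dots,N-1\}$. A representation of the Cuntz algebra $\mathcal{O}_N$ on a Hilbert space $\mathcal{H}$ is a family $(S_i)_{i\in\mathbb{Z}_N}$ of bounded operators on $\mathcal{H}$ with $S_i^*S_j=\delta_{ij}I$ for all $i,j$ and $\sum_{i\in\mathbb{Z}_N}S_iS_i^*=I$. For a finite word $I=i_1\dots i_n$, $S_I:=S_{i_1}\cdots S_{i_n}$. Two representations are unitarily equivalent if there is a unitary $U:\mathcal{H}\to\tilde{\mathcal{H}}$ with $US_i=\tilde S_iU$ for all $i\in\mathbb{Z}_N$. $\mathcal{K}_N=\mathbb{Z}_N^{\mathbb{N}}$ is the space of infinite words with the product topology and $\sigma(\omega_1\omega_2\dots)=\omega_2\omega_3\dots$ is the shift. The projection valued measure $P$ associated to a representation is the unique projection valued measure on the Borel sets of $\mathcal{K}_N$ with $P(\{\omega:\omega_1=i_1,\dots,\omega_k=i_k\})=S_IS_I^*$ for every finite word $I=i_1\dots i_k$. Write $P(\omega)=P(\{\omega\})$. The representation is purely atomic if there is a subset $\Omega'\subset\mathcal{K}_N$ with $\oplus_{\omega\in\Omega'}P(\omega)=I$; then $\operatorname{supp}(P)=\{\omega\in\mathcal{K}_N:P(\omega)\neq0\}$. A word $\omega$ is a cycle if $\sigma^p(\omega)=\omega$ for some $p>0$; then $\omega$ is the infinite repetition of the finite word $I=\omega_1\dots\omega_p$, written $\omega=\underline I$. In this case $S_I$ maps $P(\omega)\mathcal{H}$ unitarily onto itself. *)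

theory Defs
  imports "HOL-Analysis.Analysis" "HOL-Library.Omega_Words_Fun"
begin

section \<open>Complex Hilbert spaces\<close>

class complex_vector = real_vector +
  fixes scaleC :: "complex \<Rightarrow> 'a \<Rightarrow> 'a" (infixr \<open>*\<^sub>C\<close> 75)
  assumes scaleC_add_right: "c *\<^sub>C (x + y) = c *\<^sub>C x + c *\<^sub>C y"
    and scaleC_add_left: "(c + d) *\<^sub>C x = c *\<^sub>C x + d *\<^sub>C x"
    and scaleC_scaleC: "c *\<^sub>C (d *\<^sub>C x) = (c * d) *\<^sub>C x"
    and scaleR_scaleC: "r *\<^sub>R x = complex_of_real r *\<^sub>C x"

global_interpretation complex_vector: vector_space "scaleC :: complex \<Rightarrow> 'a \<Rightarrow> 'a::complex_vector"
  defines cspan = complex_vector.span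
proof unfold_locales
  show "1 *\<^sub>C x = x" for x :: 'a
    using scaleR_scaleC[of 1 x] by simp
qed (simp_all add: scaleC_add_right scaleC_add_left scaleC_scaleC)

text \<open>The inner product is linear in the second argument and conjugate linear in the first.\<close>

class complex_inner = complex_vector + real_normed_vector +
  fixes cinner :: "'a \<Rightarrow> 'a \<Rightarrow> complex"
  assumes cinner_commute: "cinner x y = cnj (cinner y x)"
    and cinner_add_right: "cinner x (y + z) = cinner x y + cinner x z"
    and cinner_scaleC_right: "cinner x (c *\<^sub>C y) = c * cinner x y"
    and cinner_self: "cinner x x = complex_of_real ((norm x)\<^sup>2)"

class chilbert_space = complex_inner + complete_space

definition bounded_clinear :: "('a::complex_inner \<Rightarrow> 'b::complex_inner) \<Rightarrow> bool" where
  "bounded_clinear T \<longleftrightarrow>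
     Vector_Spaces.linear scaleC scaleC T \<and> (\<exists>C. \<forall>x. norm (T x) \<le> C * norm x)"

text \<open>As for the constant \<open>adjoint\<close> on real inner product spaces, the choice is
  meaningful only for operators that have an adjoint; by Riesz representation these include
  the bounded operators on a Hilbert space, and then the choice is unique.\<close>

definition cadjoint :: "('a::complex_inner \<Rightarrow> 'b::complex_inner) \<Rightarrow> 'b \<Rightarrow> 'a" where
  "cadjoint T = (SOME T'. \<forall>x y. cinner (T x) y = cinner x (T' y))"

definition orthogonal_projection :: "('a::chilbert_space \<Rightarrow> 'a) \<Rightarrow> bool" where
  "orthogonal_projection T \<longleftrightarrow> bounded_clinear T \<and> T \<circ> T = T \<and> cadjoint T = T"

text \<open>Unitary maps between linear subspaces \<open>M\<close> and \<open>M'\<close>. The values of \<open>U\<close> outside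
  \<open>M\<close> are irrelevant.\<close>

definition unitary_between ::
    "'a::complex_inner set \<Rightarrow> 'b::complex_inner set \<Rightarrow> ('a \<Rightarrow> 'b) \<Rightarrow> bool" where
  "unitary_between M M' U \<longleftrightarrow>
     (\<forall>x\<in>M. \<forall>y\<in>M. U (x + y) = U x + U y) \<and>
     (\<forall>c. \<forall>x\<in>M. U (c *\<^sub>C x) = c *\<^sub>C U x) \<and>
     (\<forall>x\<in>M. \<forall>y\<in>M. cinner (U x) (U y) = cinner x y) \<and>
     U ` M = M'"

definition orthonormal_basis :: "'a::complex_inner set \<Rightarrow> 'a set \<Rightarrow> bool" where
  "orthonormal_basis M B \<longleftrightarrow>
     (\<forall>x\<in>B. \<forall>y\<in>B. cinner x y = (if x = y then 1 else 0)) \<and> closure (cspan B) = M"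

text \<open>The Hilbert dimension of a closed subspace as a cardinal number, which in HOL is a
  well-order determined up to order isomorphism. All orthonormal bases of \<open>M\<close> have the same
  cardinality, so up to this isomorphism the choice of the basis does not matter; equality of
  dimensions is membership in \<open>ordIso\<close>.\<close>

definition hilbert_dim :: "'a::complex_inner set \<Rightarrow> 'a rel" where
  "hilbert_dim M = card_of (SOME B. orthonormal_basis M B)"

definition same_hilbert_dim :: "'a::complex_inner set \<Rightarrow> 'b::complex_inner set \<Rightarrow> bool" where
  "same_hilbert_dim M M' \<longleftrightarrow> (hilbert_dim M, hilbert_dim M') \<in> ordIso"


section \<open>Infinite words\<close>

text \<open>The alphabet is \<open>{..<N}\<close>; the letter \<open>\<omega>\<^sub>k\<close> of the mathematical notation is \<open>\<omega> (k - 1)\<close>.\<close>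

definition word_topology :: "nat \<Rightarrow> (nat \<Rightarrow> nat) topology" where
  "word_topology N = product_topology (\<lambda>_. discrete_topology {..<N}) UNIV"

definition inf_words :: "nat \<Rightarrow> (nat \<Rightarrow> nat) set" where
  "inf_words N = {\<omega>. \<forall>n. \<omega> n < N}"

definition word_borel :: "nat \<Rightarrow> (nat \<Rightarrow> nat) measure" where
  "word_borel N = sigma (inf_words N) {A. openin (word_topology N) A}"

lemma topspace_word_topology: "topspace (word_topology N) = inf_words N"
  by (auto simp: word_topology_def inf_words_def)

lemma space_word_borel: "space (word_borel N) = inf_words N"
  by (simp add: word_borel_def space_measure_of_conv)

definition cylinder :: "nat \<Rightarrow> nat list \<Rightarrow> (nat \<Rightarrow> nat) set" where
  "cylinder N I = {\<omega> \<in> inf_words N. \<forall>k<length I. \<omega> k = I ! k}"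

definition shift :: "(nat \<Rightarrow> nat) \<Rightarrow> nat \<Rightarrow> nat" where
  "shift \<omega> = (\<lambda>n. \<omega> (Suc n))"

definition is_cycle :: "(nat \<Rightarrow> nat) \<Rightarrow> bool" where
  "is_cycle \<omega> \<longleftrightarrow> (\<exists>p>0. (shift ^^ p) \<omega> = \<omega>)"


section \<open>Representations of the Cuntz algebra\<close>

text \<open>Only the operators \<open>S i\<close> with \<open>i < N\<close> are relevant.\<close>

definition cuntz_rep :: "nat \<Rightarrow> (nat \<Rightarrow> 'a::chilbert_space \<Rightarrow> 'a) \<Rightarrow> bool" where
  "cuntz_rep N S \<longleftrightarrow>
     (\<forall>i<N. bounded_clinear (S i)) \<and>
     (\<forall>i<N. \<forall>j<N. cadjoint (S i) \<circ> S j = (if i = j then id else (\<lambda>_. 0))) \<and>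
     (\<forall>x. (\<Sum>i<N. S i (cadjoint (S i) x)) = x)"

definition unitarily_equivalent ::
    "nat \<Rightarrow> (nat \<Rightarrow> 'a::chilbert_space \<Rightarrow> 'a) \<Rightarrow> (nat \<Rightarrow> 'b::chilbert_space \<Rightarrow> 'b) \<Rightarrow> bool" where
  "unitarily_equivalent N S S' \<longleftrightarrow>
     (\<exists>U. unitary_between UNIV UNIV U \<and> (\<forall>i<N. U \<circ> S i = S' i \<circ> U))"

definition word_op :: "(nat \<Rightarrow> 'a \<Rightarrow> 'a) \<Rightarrow> nat list \<Rightarrow> 'a \<Rightarrow> 'a" where
  "word_op S I = foldr (\<lambda>i T. S i \<circ> T) I id"


section \<open>Projection valued measures\<close>

text \<open>Countable additivity is meant in the strong operator topology. The values of \<open>P\<close>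
  outside \<open>sets M\<close> are irrelevant.\<close>

definition projection_valued_measure ::
    "'w measure \<Rightarrow> ('w set \<Rightarrow> 'a::chilbert_space \<Rightarrow> 'a) \<Rightarrow> bool" where
  "projection_valued_measure M P \<longleftrightarrow>
     (\<forall>E\<in>sets M. orthogonal_projection (P E)) \<and>
     P {} = (\<lambda>_. 0) \<and> P (space M) = id \<and>
     (\<forall>E\<in>sets M. \<forall>F\<in>sets M. P (E \<inter> F) = P E \<circ> P F) \<and>
     (\<forall>A. range A \<subseteq> sets M \<and> disjoint_family A \<longrightarrow>
        (\<forall>x. (\<lambda>n::nat. P (A n) x) sums P (\<Union>n. A n) x))"

text \<open>For a representation \<open>S\<close> there is exactly one such measure (on the Borel sets).\<close>

definition associated_pvm ::
    "nat \<Rightarrow> (nat \<Rightarrow> 'a::chilbert_space \<Rightarrow> 'a) \<Rightarrow> ((nat \<Rightarrow> nat) set \<Rightarrow> 'a \<Rightarrow> 'a) \<Rightarrow> bool" where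
  "associated_pvm N S P \<longleftrightarrow>
     projection_valued_measure (word_borel N) P \<and>
     (\<forall>I. set I \<subseteq> {..<N} \<longrightarrow> P (cylinder N I) = word_op S I \<circ> cadjoint (word_op S I))"

text \<open>The projections of distinct singletons are mutually orthogonal for every projection
  valued measure, so their direct sum is their sum in the strong operator topology.\<close>

definition purely_atomic ::
    "nat \<Rightarrow> ((nat \<Rightarrow> nat) set \<Rightarrow> 'a::chilbert_space \<Rightarrow> 'a) \<Rightarrow> bool" where
  "purely_atomic N P \<longleftrightarrow>
     (\<exists>\<Omega>\<subseteq>inf_words N. \<forall>x. ((\<lambda>\<omega>. P {\<omega>} x) has_sum x) \<Omega>)"

definition atomic_support ::
    "nat \<Rightarrow> ((nat \<Rightarrow> nat) set \<Rightarrow> 'a::chilbert_space \<Rightarrow> 'a) \<Rightarrow> (nat \<Rightarrow> nat) set" where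
  "atomic_support N P = {\<omega> \<in> inf_words N. P {\<omega>} \<noteq> (\<lambda>_. 0)}"

end

theory Submission
  imports Defs
begin

text \<open>
  Everything happens on the atoms \<open>P {\<omega>} H\<close>. Since \<open>P {\<omega>}\<close> is the strong limit of the
  projections \<open>S\<^sub>I S\<^sub>I\<^sup>*\<close> over the prefixes \<open>I\<close> of \<open>\<omega>\<close>, the operator \<open>S i\<close> maps the atom of
  \<open>\<omega>\<close> unitarily onto the atom of \<open>i ## \<omega>\<close> (\<open>generator_atom\<close>, \<open>word_unitary\<close>), and
  in the purely atomic case the whole space is the orthogonal sum of the atoms
  (\<open>atomic_resolution\<close>).

  If \<open>U\<close> is an equivalence, it carries \<open>S\<^sub>I S\<^sub>I\<^sup>*\<close> to the corresponding projection of the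
  other representation, hence atoms to atoms (\<open>equivalence_atom\<close>). Its restrictions to the
  atoms give the equality of supports and dimensions and the maps required at the cycles.

  Conversely, a family of unitary maps between the atoms of the two representations glues to a
  unitary \<open>U\<close> of the whole spaces (\<open>unitary_glue\<close>), and \<open>U\<close> is an equivalence when
  the family is compatible with every step from \<open>\<omega>\<close> to \<open>i ## \<omega>\<close>. Such steps stay inside an
  orbit, that is, a class of words with a common tail, so the orbits can be treated separately.
  In an orbit fix a word \<open>r\<close> and a unitary \<open>V\<close> between its two atoms. A word
  \<open>\<omega> = J \<frown> \<tau>\<close> with \<open>r = K \<frown> \<tau>\<close> receives the map
  \<open>S'\<^sub>J S'\<^sub>K\<^sup>* V S\<^sub>K S\<^sub>J\<^sup>*\<close> (\<open>transport\<close>). It depends only on the difference of the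
  lengths of \<open>J\<close> and \<open>K\<close>. If the orbit contains no cycle, that difference is determined by
  \<open>\<omega>\<close>, and any \<open>V\<close> will do (\<open>orbit_family_aperiodic\<close>). If it contains a cycle, \<open>r\<close> is
  taken to be one, and the only additional constraint is met on returning to \<open>r\<close> after one period
  \<open>I\<close>: \<open>V\<close> has to intertwine \<open>S\<^sub>I\<close> and \<open>S'\<^sub>I\<close> (\<open>orbit_family_cycle\<close>).

  The Hilbert space theory behind this rests on one fact: an orthogonal series converges if
  and only if the squares of the norms of its terms are summable. It yields the gluing lemma,
  expansions in orthonormal bases, the existence of adjoints, and the equivalence of having the
  same dimension with the existence of a unitary map (\<open>same_hilbert_dim_iff_unitary\<close>).
\<close>

section \<open>Inner products and bounded operators\<close>

lemma cinner_add_left: "cinner (x + y) z = cinner x z + cinner y z"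
  by (subst (1 2 3) cinner_commute) (simp add: cinner_add_right)

lemma cinner_scaleC_left: "cinner (c *\<^sub>C x) y = cnj c * cinner x y"
  by (subst (1 2) cinner_commute) (simp add: cinner_scaleC_right)

lemma cinner_zero_right [simp]: "cinner x 0 = 0"
  using cinner_add_right[of x 0 0] by simp

lemma cinner_zero_left [simp]: "cinner 0 x = 0"
  using cinner_add_left[of 0 0 x] by simp

lemma cinner_diff_right: "cinner x (y - z) = cinner x y - cinner x z"
  using cinner_add_right[of x "y - z" z] by simp

lemma cinner_diff_left: "cinner (x - y) z = cinner x z - cinner y z"
  using cinner_add_left[of "x - y" y z] by simp

lemma cinner_sum_right: "cinner x (\<Sum>i\<in>F. f i) = (\<Sum>i\<in>F. cinner x (f i))"
  by (induction F rule: infinite_finite_induct) (simp_all add: cinner_add_right)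

lemma cinner_sum_left: "cinner (\<Sum>i\<in>F. f i) x = (\<Sum>i\<in>F. cinner (f i) x)"
  by (induction F rule: infinite_finite_induct) (simp_all add: cinner_add_left)

lemma cinner_self_eq_0_iff [simp]: "cinner x x = 0 \<longleftrightarrow> x = 0"
  by (simp add: cinner_self)

lemma cinner_eq_0_commute: "cinner x y = 0 \<longleftrightarrow> cinner y x = 0"
  by (subst cinner_commute) simp

lemma cinner_ext: "(\<And>z. cinner z x = cinner z y) \<Longrightarrow> x = y"
  by (metis cinner_diff_right cinner_self_eq_0_iff eq_iff_diff_eq_0)

lemma norm_scaleC [simp]: "norm (c *\<^sub>C (x::'a::complex_inner)) = cmod c * norm x"
proof -
  have "complex_of_real ((norm (c *\<^sub>C x))\<^sup>2) = (c * cnj c) * cinner x x"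
    unfolding cinner_self[symmetric] by (simp add: cinner_scaleC_left cinner_scaleC_right)
  also have "\<dots> = complex_of_real ((cmod c * norm x)\<^sup>2)"
    by (simp only: cinner_self complex_norm_square[symmetric] power_mult_distrib of_real_mult)
  finally have "(norm (c *\<^sub>C x))\<^sup>2 = (cmod c * norm x)\<^sup>2"
    using of_real_eq_iff by blast
  then show ?thesis
    by (simp add: power2_eq_iff_nonneg)
qed

lemma norm_add_square_orthogonal:
  assumes "cinner x y = 0"
  shows "(norm (x + y))\<^sup>2 = (norm x)\<^sup>2 + (norm y)\<^sup>2"
proof -
  have "cinner y x = 0"
    using assms cinner_eq_0_commute by blast
  then have "complex_of_real ((norm (x + y))\<^sup>2) = complex_of_real ((norm x)\<^sup>2 + (norm y)\<^sup>2)"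
    using assms unfolding of_real_add cinner_self[symmetric]
    by (simp add: cinner_add_left cinner_add_right)
  then show ?thesis
    using of_real_eq_iff by blast
qed

lemma Cauchy_Schwarz: "cmod (cinner x y) \<le> norm x * norm y"
proof (cases "x = 0")
  case False
  define c where "c = cinner x y / cinner x x"
  define z where "z = y - c *\<^sub>C x"
  have "cinner x z = 0"
    using False by (simp add: z_def c_def cinner_diff_right cinner_scaleC_right)
  then have "cinner (c *\<^sub>C x) z = 0"
    by (simp add: cinner_scaleC_left)
  then have "(norm (c *\<^sub>C x + z))\<^sup>2 = (norm (c *\<^sub>C x))\<^sup>2 + (norm z)\<^sup>2"
    by (rule norm_add_square_orthogonal)
  then have "(norm (c *\<^sub>C x))\<^sup>2 \<le> (norm y)\<^sup>2"
    by (simp add: z_def)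
  then have "cmod c * norm x \<le> norm y"
    by (metis norm_ge_zero norm_scaleC power2_le_imp_le)
  moreover have "cmod c * norm x = cmod (cinner x y) / norm x"
    using False by (simp add: c_def cinner_self norm_divide norm_mult power2_eq_square)
  ultimately show ?thesis
    using False by (simp add: pos_divide_le_eq mult.commute)
qed simp

lemma scaleR_cinner: "cinner (r *\<^sub>R x) y = r *\<^sub>R cinner x y" "cinner x (r *\<^sub>R y) = r *\<^sub>R cinner x y"
  unfolding scaleR_scaleC[of r x] scaleR_scaleC[of r y]
  by (simp_all add: cinner_scaleC_left cinner_scaleC_right scaleR_conv_of_real)

lemma bounded_bilinear_cinner: "bounded_bilinear cinner"
proof
  show "\<exists>K. \<forall>a b. norm (cinner a b) \<le> norm (a::'a) * norm b * K"
    by (rule exI[of _ 1]) (simp add: Cauchy_Schwarz)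
qed (simp_all add: cinner_add_left cinner_add_right scaleR_cinner)

lemmas bounded_linear_cinner_left = bounded_bilinear.bounded_linear_left[OF bounded_bilinear_cinner]
lemmas bounded_linear_cinner_right = bounded_bilinear.bounded_linear_right[OF bounded_bilinear_cinner]
lemmas continuous_on_cinner = bounded_bilinear.continuous_on[OF bounded_bilinear_cinner]

lemma bounded_clinear_iff:
  "bounded_clinear T \<longleftrightarrow> (\<forall>x y. T (x + y) = T x + T y) \<and> (\<forall>c x. T (c *\<^sub>C x) = c *\<^sub>C T x) \<and>
     (\<exists>C. \<forall>x. norm (T x) \<le> C * norm x)"
  unfolding bounded_clinear_def
  by (subst Vector_Spaces.linear_iff)
     (auto simp: complex_vector.vector_space_axioms)

lemma bounded_clinear_add: "bounded_clinear T \<Longrightarrow> T (x + y) = T x + T y"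
  and bounded_clinear_scaleC: "bounded_clinear T \<Longrightarrow> T (c *\<^sub>C x) = c *\<^sub>C T x"
  by (auto simp: bounded_clinear_iff)

lemma bounded_clinear_bounded_linear: "bounded_clinear T \<Longrightarrow> bounded_linear T"
proof -
  assume T: "bounded_clinear T"
  then obtain C where C: "norm (T x) \<le> C * norm x" for x
    unfolding bounded_clinear_iff by blast
  show "bounded_linear T"
  proof (rule bounded_linear_intro)
    show "norm (T x) \<le> norm x * C" for x
      using C[of x] by (simp only: mult.commute)
    show "T (r *\<^sub>R x) = r *\<^sub>R T x" for r x
      unfolding scaleR_scaleC by (rule bounded_clinear_scaleC[OF T])
  qed (rule bounded_clinear_add[OF T])
qed

lemma bounded_clinear_zero: "bounded_clinear T \<Longrightarrow> T 0 = 0"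
  using bounded_clinear_add[of T 0 0] by simp

lemma bounded_clinear_id: "bounded_clinear id"
  unfolding bounded_clinear_iff by (auto intro!: exI[of _ 1])

lemma bounded_clinear_scale: "bounded_clinear (\<lambda>x. c *\<^sub>C x)"
  unfolding bounded_clinear_iff
  by (simp add: scaleC_add_right scaleC_scaleC mult.commute) (metis mult.commute order_refl)

lemma bounded_clinear_compose:
  assumes "bounded_clinear T" "bounded_clinear U"
  shows "bounded_clinear (T \<circ> U)"
proof -
  have "bounded_linear (\<lambda>x. T (U x))"
    using assms[THEN bounded_clinear_bounded_linear] by (rule bounded_linear_compose)
  then have "\<exists>C. \<forall>x. norm (T (U x)) \<le> C * norm x"
    by (metis bounded_linear.bounded mult.commute)
  then show ?thesis
    using assms unfolding bounded_clinear_iff by simp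
qed

definition closed_csubspace :: "'a::complex_inner set \<Rightarrow> bool" where
  "closed_csubspace M \<longleftrightarrow> complex_vector.subspace M \<and> closed M"

lemma closed_csubspaceD:
  assumes "closed_csubspace M"
  shows "0 \<in> M" and "x \<in> M \<Longrightarrow> y \<in> M \<Longrightarrow> x + y \<in> M" and "x \<in> M \<Longrightarrow> c *\<^sub>C x \<in> M"
    and "x \<in> M \<Longrightarrow> y \<in> M \<Longrightarrow> x - y \<in> M" and "(\<And>i. i \<in> F \<Longrightarrow> f i \<in> M) \<Longrightarrow> sum f F \<in> M"
proof -
  have M: "complex_vector.subspace M"
    using assms by (simp add: closed_csubspace_def)
  show "0 \<in> M" "x \<in> M \<Longrightarrow> y \<in> M \<Longrightarrow> x + y \<in> M" "x \<in> M \<Longrightarrow> c *\<^sub>C x \<in> M"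
      "x \<in> M \<Longrightarrow> y \<in> M \<Longrightarrow> x - y \<in> M"
    using M by (simp_all add: complex_vector.subspace_0 complex_vector.subspace_add
        complex_vector.subspace_scale complex_vector.subspace_diff)
  show "(\<And>i. i \<in> F \<Longrightarrow> f i \<in> M) \<Longrightarrow> sum f F \<in> M"
    using M by (rule complex_vector.subspace_sum)
qed

lemma closed_csubspace_UNIV: "closed_csubspace UNIV"
  by (simp add: closed_csubspace_def)

lemma has_sum_in_closed_csubspace:
  assumes "closed_csubspace M" "(f has_sum s) A" "\<And>i. i \<in> A \<Longrightarrow> f i \<in> M"
  shows "s \<in> M"
proof (rule Lim_in_closed_set)
  show "closed M"
    using assms by (simp add: closed_csubspace_def)
  show "\<forall>\<^sub>F F in finite_subsets_at_top A. sum f F \<in> M"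
    by (rule eventually_finite_subsets_at_top_weakI) (use assms in \<open>auto intro!: closed_csubspaceD\<close>)
  show "(sum f \<longlongrightarrow> s) (finite_subsets_at_top A)"
    using assms by (simp add: has_sum_def)
qed simp

section \<open>Orthogonal series\<close>

definition orthogonal_family :: "'i set \<Rightarrow> ('i \<Rightarrow> 'a::complex_inner) \<Rightarrow> bool" where
  "orthogonal_family A u \<longleftrightarrow> (\<forall>i\<in>A. \<forall>j\<in>A. i \<noteq> j \<longrightarrow> cinner (u i) (u j) = 0)"

lemma norm_sum_square_orthogonal:
  assumes "finite F" "orthogonal_family F u"
  shows "(norm (sum u F))\<^sup>2 = (\<Sum>i\<in>F. (norm (u i))\<^sup>2)"
  using assms
proof (induction F rule: finite_induct)
  case (insert i F)
  have "cinner (u i) (sum u F) = 0"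
    using insert.hyps insert.prems by (auto simp: cinner_sum_right orthogonal_family_def intro!: sum.neutral)
  then show ?case
    using insert by (auto simp: norm_add_square_orthogonal orthogonal_family_def)
qed simp

lemma orthogonal_family_subset: "orthogonal_family A u \<Longrightarrow> F \<subseteq> A \<Longrightarrow> orthogonal_family F u"
  by (auto simp: orthogonal_family_def)

text \<open>By the theorem of Pythagoras the distance between two partial sums is governed by a tail of
  the series of squared norms, so the partial sums form a Cauchy filter.\<close>

lemma orthogonal_summable:
  fixes u :: "'i \<Rightarrow> 'a::chilbert_space"
  assumes orth: "orthogonal_family A u" and sq: "(\<lambda>i. (norm (u i))\<^sup>2) summable_on A"
  shows "u summable_on A"
proof -
  define q where "q i = (norm (u i))\<^sup>2" for i
  obtain L where L: "(q has_sum L) A"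
    using sq unfolding q_def summable_on_def by blast
  have "\<exists>Q. eventually Q (finite_subsets_at_top A) \<and>
          (\<forall>F F'. Q F \<and> Q F' \<longrightarrow> dist (sum u F) (sum u F') < e)" if "e > 0" for e
  proof -
    \<comment> \<open>Squares within \<open>(e / 3)\<^sup>2\<close> of their sum put every larger partial sum within \<open>e / 3\<close>
      of the one over \<open>F0\<close>, and hence any two of them within \<open>2 * e / 3\<close> of each other.\<close>
    have "0 < (e / 3)\<^sup>2"
      using that by simp
    from has_sum_finite_approximation[OF L this]
    obtain F0 where F0: "finite F0" "F0 \<subseteq> A" "dist (sum q F0) L \<le> (e / 3)\<^sup>2"
      by blast
    define Q where "Q F \<longleftrightarrow> finite F \<and> F0 \<subseteq> F \<and> F \<subseteq> A" for F
    have near: "dist (sum u F) (sum u F0) \<le> e / 3" if "Q F" for F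
    proof -
      have F: "finite F" "F0 \<subseteq> F" "F \<subseteq> A"
        using that by (auto simp: Q_def)
      have "(dist (sum u F) (sum u F0))\<^sup>2 = (norm (sum u (F - F0)))\<^sup>2"
        using F F0 by (simp add: dist_norm sum_diff)
      also have "\<dots> = sum q (F - F0)"
        unfolding q_def using F
        by (intro norm_sum_square_orthogonal orthogonal_family_subset[OF orth]) auto
      also have "\<dots> = sum q F - sum q F0"
        using F F0 by (simp add: sum_diff)
      also have "\<dots> \<le> L - sum q F0"
        using finite_sum_le_has_sum[OF L F(1,3)] by (simp add: q_def)
      also have "\<dots> \<le> (e / 3)\<^sup>2"
        using F0(3) unfolding dist_real_def by linarith
      finally show ?thesis
        by (rule power2_le_imp_le) (use \<open>e > 0\<close> in simp)
    qed
    have "dist (sum u F) (sum u F') < e" if "Q F" "Q F'" for F F'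
    proof -
      have "dist (sum u F) (sum u F') \<le> e / 3 + e / 3"
        by (rule order_trans[OF dist_triangle2 add_mono[OF near near]]) (use that in auto)
      then show ?thesis
        using \<open>e > 0\<close> by simp
    qed
    moreover have "eventually Q (finite_subsets_at_top A)"
      using F0 unfolding Q_def eventually_finite_subsets_at_top by blast
    ultimately show ?thesis
      by blast
  qed
  then have "cauchy_filter (filtermap (sum u) (finite_subsets_at_top A))"
    by (simp add: cauchy_filter_metric_filtermap)
  moreover have "complete (UNIV::'a set)"
    by (meson Cauchy_convergent UNIV_I complete_def convergent_def)
  ultimately obtain s where "(sum u \<longlongrightarrow> s) (finite_subsets_at_top A)"
    using complete_uniform[where S=UNIV] by (force simp add: filterlim_def)
  then show ?thesis
    using summable_on_def has_sum_def by blast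
qed

lemma has_sum_cinner_right:
  "(u has_sum s) A \<Longrightarrow> ((\<lambda>i. cinner x (u i)) has_sum cinner x s) A"
  by (rule has_sum_bounded_linear[OF bounded_linear_cinner_right])

lemma has_sum_cinner_left:
  "(u has_sum s) A \<Longrightarrow> ((\<lambda>i. cinner (u i) x) has_sum cinner s x) A"
  by (rule has_sum_bounded_linear[OF bounded_linear_cinner_left])

lemma has_sum_only_one:
  fixes f :: "'i \<Rightarrow> 'a::{t2_space,topological_comm_monoid_add}"
  assumes "(f has_sum s) A" "j \<in> A" "\<And>i. i \<in> A \<Longrightarrow> i \<noteq> j \<Longrightarrow> f i = 0"
  shows "s = f j"
  by (rule has_sum_unique[OF assms(1) has_sum_finite_neutralI[of "{j}"]]) (use assms in auto)

lemma cinner_has_sum_orthogonal: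
  assumes "(v has_sum t) A" "j \<in> A" "\<And>i. i \<in> A \<Longrightarrow> i \<noteq> j \<Longrightarrow> cinner x (v i) = 0"
  shows "cinner x t = cinner x (v j)"
  using has_sum_only_one[OF has_sum_cinner_right[OF assms(1)] assms(2)] assms(3) by blast

lemma has_sum_cinner_diagonal:
  assumes "(u has_sum s) A" "(v has_sum t) A"
    and "\<And>i j. i \<in> A \<Longrightarrow> j \<in> A \<Longrightarrow> i \<noteq> j \<Longrightarrow> cinner (u i) (v j) = 0"
  shows "((\<lambda>i. cinner (u i) (v i)) has_sum cinner s t) A"
proof -
  have "((\<lambda>i. cinner (u i) t) has_sum cinner s t) A"
    by (rule has_sum_cinner_left) fact
  moreover have "cinner (u i) t = cinner (u i) (v i)" if "i \<in> A" for i
    using that assms(3) by (intro cinner_has_sum_orthogonal[OF assms(2)]) auto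
  ultimately show ?thesis
    by (simp cong: has_sum_cong)
qed

lemma orthogonal_has_sum_norm_square:
  assumes "orthogonal_family A u" "(u has_sum s) A"
  shows "((\<lambda>i. (norm (u i))\<^sup>2) has_sum (norm s)\<^sup>2) A"
proof -
  have "((\<lambda>i. cinner (u i) (u i)) has_sum cinner s s) A"
    using assms by (intro has_sum_cinner_diagonal) (auto simp: orthogonal_family_def)
  from has_sum_bounded_linear[OF bounded_linear_Re this] show ?thesis
    by (simp add: cinner_self del: of_real_power)
qed

text \<open>Convergence of an orthogonal series depends on the norms of its terms alone, so it
  carries over to any other orthogonal family with terms of the same norms.\<close>

lemma orthogonal_summable_transfer:
  fixes v :: "'i \<Rightarrow> 'b::chilbert_space"
  assumes "orthogonal_family A u" "u summable_on A" "orthogonal_family A v"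
    and "\<And>i. i \<in> A \<Longrightarrow> norm (v i) = norm (u i)"
  shows "v summable_on A"
proof -
  obtain s where "(u has_sum s) A"
    using assms(2) by (auto simp: summable_on_def)
  then have "(\<lambda>i. (norm (u i))\<^sup>2) summable_on A"
    by (rule has_sum_imp_summable[OF orthogonal_has_sum_norm_square[OF assms(1)]])
  then have "(\<lambda>i. (norm (v i))\<^sup>2) summable_on A"
    using assms(4) by (simp cong: summable_on_cong)
  then show ?thesis
    by (rule orthogonal_summable[OF assms(3)])
qed

section \<open>Unitary maps between subspaces\<close>

lemma unitary_betweenD:
  assumes "unitary_between M M' U"
  shows "x \<in> M \<Longrightarrow> y \<in> M \<Longrightarrow> U (x + y) = U x + U y"
    and "x \<in> M \<Longrightarrow> U (c *\<^sub>C x) = c *\<^sub>C U x"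
    and "x \<in> M \<Longrightarrow> y \<in> M \<Longrightarrow> cinner (U x) (U y) = cinner x y"
    and "U ` M = M'"
    and "x \<in> M \<Longrightarrow> U x \<in> M'"
  using assms by (auto simp: unitary_between_def)

lemma unitary_between_norm:
  assumes "unitary_between M M' U" "x \<in> M"
  shows "norm (U x) = norm x"
proof -
  have "complex_of_real ((norm (U x))\<^sup>2) = complex_of_real ((norm x)\<^sup>2)"
    unfolding cinner_self[symmetric] using unitary_betweenD(3)[OF assms(1)] assms(2) by blast
  then have "(norm (U x))\<^sup>2 = (norm x)\<^sup>2"
    using of_real_eq_iff by blast
  then show ?thesis
    by (simp add: power2_eq_iff_nonneg)
qed

lemma unitary_between_compose:
  assumes "unitary_between M M' U" "unitary_between M' M'' V"
  shows "unitary_between M M'' (V \<circ> U)"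
  using assms unfolding unitary_between_def by (auto simp: image_comp[symmetric])

lemma unitary_between_restrict:
  assumes "unitary_between M M' U" "K \<subseteq> M" "U ` K = K'"
  shows "unitary_between K K' U"
  using assms unfolding unitary_between_def by (auto simp: subset_iff)

lemma unitary_between_UNIV_bounded_clinear:
  assumes "unitary_between UNIV M U"
  shows "bounded_clinear U"
  using assms unitary_between_norm[OF assms]
  unfolding bounded_clinear_iff unitary_between_def by (auto intro!: exI[of _ 1])

text \<open>A resolution of the closed subspace \<open>M\<close> into the mutually orthogonal ranges of the
  \<open>p i\<close>, which by \<open>resolution_absorb\<close> act on \<open>M\<close> as projections.\<close>

definition orthogonal_resolution ::
    "'a::complex_inner set \<Rightarrow> 'i set \<Rightarrow> ('i \<Rightarrow> 'a \<Rightarrow> 'a) \<Rightarrow> bool" where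
  "orthogonal_resolution M A p \<longleftrightarrow> closed_csubspace M \<and>
     (\<forall>i\<in>A. bounded_clinear (p i) \<and> range (p i) \<subseteq> M) \<and>
     (\<forall>i\<in>A. \<forall>j\<in>A. i \<noteq> j \<longrightarrow> (\<forall>x y. cinner (p i x) (p j y) = 0)) \<and>
     (\<forall>x\<in>M. ((\<lambda>i. p i x) has_sum x) A)"

lemma resolutionD:
  assumes "orthogonal_resolution M A p"
  shows "closed_csubspace M" and "i \<in> A \<Longrightarrow> bounded_clinear (p i)" and "i \<in> A \<Longrightarrow> p i x \<in> M"
    and "i \<in> A \<Longrightarrow> j \<in> A \<Longrightarrow> i \<noteq> j \<Longrightarrow> cinner (p i x) (p j y) = 0"
    and "x \<in> M \<Longrightarrow> ((\<lambda>i. p i x) has_sum x) A"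
  using assms by (auto simp: orthogonal_resolution_def)

text \<open>Expand \<open>y = p j x\<close> in the resolution. For \<open>k \<noteq> j\<close> the term \<open>p k y\<close> is orthogonal to all
  other terms, so \<open>cinner (p k y) y\<close> is its squared norm; but it is also orthogonal to \<open>y\<close>. Hence
  only the term \<open>p j y\<close> is left.\<close>

lemma resolution_absorb:
  assumes res: "orthogonal_resolution M A p" and "i \<in> A" "j \<in> A"
  shows "p i (p j x) = (if i = j then p j x else 0)"
proof -
  define y where "y = p j x"
  have "y \<in> M"
    unfolding y_def using res \<open>j \<in> A\<close> by (rule resolutionD)
  then have sum: "((\<lambda>k. p k y) has_sum y) A"
    by (rule resolutionD(5)[OF res])
  have off: "p k y = 0" if "k \<in> A" "k \<noteq> j" for k
  proof -
    have "cinner (p k y) y = cinner (p k y) (p k y)"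
      by (rule cinner_has_sum_orthogonal[OF sum \<open>k \<in> A\<close>]) (use resolutionD(4)[OF res] that in auto)
    moreover have "cinner (p k y) y = 0"
      unfolding y_def using resolutionD(4)[OF res \<open>k \<in> A\<close> \<open>j \<in> A\<close>] that by blast
    ultimately show ?thesis
      by simp
  qed
  have "y = p j y"
    by (rule has_sum_only_one[OF sum \<open>j \<in> A\<close>]) (use off in auto)
  with off[OF \<open>i \<in> A\<close>] show ?thesis
    by (auto simp: y_def)
qed

lemma resolution_reindex:
  assumes p: "orthogonal_resolution M B p" and f: "bij_betw f A B"
  shows "orthogonal_resolution M A (\<lambda>i. p (f i))"
  unfolding orthogonal_resolution_def
proof (intro conjI ballI impI allI)
  have fB: "f i \<in> B" if "i \<in> A" for i
    using f that by (auto simp: bij_betw_def)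
  show "bounded_clinear (p (f i))" "range (p (f i)) \<subseteq> M" if "i \<in> A" for i
    using resolutionD(2,3)[OF p fB[OF that]] by auto
  show "cinner (p (f i) x) (p (f j) y) = 0" if "i \<in> A" "j \<in> A" "i \<noteq> j" for i j x y
  proof (rule resolutionD(4)[OF p fB fB])
    show "f i \<noteq> f j"
      using f that by (auto simp: bij_betw_def inj_on_def)
  qed (use that in auto)
  show "((\<lambda>i. p (f i) x) has_sum x) A" if "x \<in> M" for x
    using resolutionD(5)[OF p that] by (subst has_sum_reindex_bij_betw[OF f])
qed (rule resolutionD(1)[OF p])

text \<open>The glued map is \<open>x \<mapsto> (\<Sum>i. u i (p i x))\<close>. The series converges because its terms are orthogonal
  and have the norms of the terms \<open>p i x\<close>; the preimage of \<open>y\<close> is obtained in the same way by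
  summing preimages of the components \<open>q i y\<close>.\<close>

lemma unitary_glue:
  fixes p :: "'i \<Rightarrow> 'a::chilbert_space \<Rightarrow> 'a" and q :: "'i \<Rightarrow> 'b::chilbert_space \<Rightarrow> 'b"
  assumes p: "orthogonal_resolution M A p" and q: "orthogonal_resolution M' A q"
    and u: "\<And>i. i \<in> A \<Longrightarrow> unitary_between (range (p i)) (range (q i)) (u i)"
  shows "\<exists>U. unitary_between M M' U \<and> (\<forall>i\<in>A. \<forall>x\<in>range (p i). U x = u i x)"
proof -
  define U where "U x = infsum (\<lambda>i. u i (p i x)) A" for x
  have u_range: "u i (p i x) \<in> range (q i)" if "i \<in> A" for i x
    using unitary_betweenD(5)[OF u[OF that]] by blast
  have q_sub: "a \<in> M'" if "i \<in> A" "a \<in> range (q i)" for i a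
    using that(2) resolutionD(3)[OF q that(1)] by auto
  have p_sub: "a \<in> M" if "i \<in> A" "a \<in> range (p i)" for i a
    using that(2) resolutionD(3)[OF p that(1)] by auto
  have q_orth: "cinner a b = 0" if "i \<in> A" "j \<in> A" "i \<noteq> j" "a \<in> range (q i)" "b \<in> range (q j)" for i j a b
    using resolutionD(4)[OF q] that by blast
  have p_orth: "cinner a b = 0" if "i \<in> A" "j \<in> A" "i \<noteq> j" "a \<in> range (p i)" "b \<in> range (p j)" for i j a b
    using resolutionD(4)[OF p] that by blast
  have U: "((\<lambda>i. u i (p i x)) has_sum U x) A" if "x \<in> M" for x
  proof -
    have "(\<lambda>i. u i (p i x)) summable_on A"
    proof (rule orthogonal_summable_transfer)
      show "orthogonal_family A (\<lambda>i. p i x)"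
        using resolutionD(4)[OF p] by (simp add: orthogonal_family_def)
      show "orthogonal_family A (\<lambda>i. u i (p i x))"
        by (simp add: orthogonal_family_def q_orth[OF _ _ _ u_range u_range])
      show "(\<lambda>i. p i x) summable_on A"
        using resolutionD(5)[OF p that] summable_on_def by blast
      show "norm (u i (p i x)) = norm (p i x)" if "i \<in> A" for i
        using unitary_between_norm[OF u[OF that]] by blast
    qed
    then show ?thesis
      by (simp add: U_def)
  qed
  note M = closed_csubspaceD[OF resolutionD(1)[OF p]]
  have "U (x + y) = U x + U y" if "x \<in> M" "y \<in> M" for x y
  proof (rule has_sum_unique)
    show "((\<lambda>i. u i (p i (x + y))) has_sum U (x + y)) A"
      using that by (intro U M)
    have "u i (p i (x + y)) = u i (p i x) + u i (p i y)" if "i \<in> A" for i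
      using unitary_betweenD(1)[OF u[OF that]] by (simp add: bounded_clinear_add[OF resolutionD(2)[OF p that]])
    then show "((\<lambda>i. u i (p i (x + y))) has_sum U x + U y) A"
      using has_sum_add[OF U[OF that(1)] U[OF that(2)]] by (simp cong: has_sum_cong)
  qed
  moreover have "U (c *\<^sub>C x) = c *\<^sub>C U x" if "x \<in> M" for c x
  proof (rule has_sum_unique)
    show "((\<lambda>i. u i (p i (c *\<^sub>C x))) has_sum U (c *\<^sub>C x)) A"
      using that by (intro U M)
    have "u i (p i (c *\<^sub>C x)) = c *\<^sub>C u i (p i x)" if "i \<in> A" for i
      using unitary_betweenD(2)[OF u[OF that]] by (simp add: bounded_clinear_scaleC[OF resolutionD(2)[OF p that]])
    moreover have "bounded_linear (\<lambda>y::'b. c *\<^sub>C y)"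
      by (rule bounded_clinear_bounded_linear[OF bounded_clinear_scale])
    ultimately show "((\<lambda>i. u i (p i (c *\<^sub>C x))) has_sum c *\<^sub>C U x) A"
      using has_sum_bounded_linear[OF _ U[OF that]] by (simp cong: has_sum_cong)
  qed
  moreover have "cinner (U x) (U y) = cinner x y" if "x \<in> M" "y \<in> M" for x y
  proof (rule has_sum_unique)
    show "((\<lambda>i. cinner (p i x) (p i y)) has_sum cinner x y) A"
      by (intro has_sum_cinner_diagonal resolutionD(5)[OF p] resolutionD(4)[OF p] that)
    have "((\<lambda>i. cinner (u i (p i x)) (u i (p i y))) has_sum cinner (U x) (U y)) A"
      by (intro has_sum_cinner_diagonal U that) (rule q_orth[OF _ _ _ u_range u_range])
    then show "((\<lambda>i. cinner (p i x) (p i y)) has_sum cinner (U x) (U y)) A"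
      using unitary_betweenD(3)[OF u] by (simp cong: has_sum_cong)
  qed
  moreover have "U ` M = M'"
  proof (intro equalityI subsetI)
    show "y \<in> M'" if y: "y \<in> U ` M" for y
    proof -
      obtain x where x: "x \<in> M" "y = U x"
        using y by blast
      show ?thesis
        unfolding x(2)
        by (rule has_sum_in_closed_csubspace[OF resolutionD(1)[OF q] U[OF x(1)]])
           (rule q_sub[OF _ u_range])
    qed
    show "y \<in> U ` M" if "y \<in> M'" for y
    proof -
      have "\<forall>i\<in>A. \<exists>x. x \<in> range (p i) \<and> u i x = q i y"
        using unitary_betweenD(4)[OF u] by (metis imageE rangeI)
      then obtain x where x: "\<And>i. i \<in> A \<Longrightarrow> x i \<in> range (p i)" "\<And>i. i \<in> A \<Longrightarrow> u i (x i) = q i y"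
        by metis
      have "x summable_on A"
      proof (rule orthogonal_summable_transfer)
        show "orthogonal_family A (\<lambda>i. q i y)"
          using resolutionD(4)[OF q] by (simp add: orthogonal_family_def)
        show "orthogonal_family A x"
          by (simp add: orthogonal_family_def p_orth[OF _ _ _ x(1) x(1)])
        show "(\<lambda>i. q i y) summable_on A"
          using resolutionD(5)[OF q that] summable_on_def by blast
        show "norm (x i) = norm (q i y)" if "i \<in> A" for i
          using unitary_between_norm[OF u[OF that] x(1)[OF that]] x(2)[OF that] by simp
      qed
      then obtain s where s: "(x has_sum s) A"
        unfolding summable_on_def by blast
      have "s \<in> M"
        by (rule has_sum_in_closed_csubspace[OF resolutionD(1)[OF p] s])
           (rule p_sub[OF _ x(1)])
      have absorb: "p j (x i) = (if j = i then x i else 0)" if "i \<in> A" "j \<in> A" for i j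
        using x(1)[OF that(1)] resolution_absorb[OF p that(2,1)] by auto
      have "p j s = x j" if "j \<in> A" for j
      proof -
        have "((\<lambda>i. p j (x i)) has_sum p j s) A"
          by (rule has_sum_bounded_linear[OF _ s])
             (rule bounded_clinear_bounded_linear[OF resolutionD(2)[OF p that]])
        from has_sum_only_one[OF this that] show ?thesis
          using absorb that by simp
      qed
      then have "((\<lambda>i. q i y) has_sum U s) A"
        using U[OF \<open>s \<in> M\<close>] x(2) by (simp cong: has_sum_cong)
      then have "U s = y"
        using resolutionD(5)[OF q that] has_sum_unique by blast
      with \<open>s \<in> M\<close> show ?thesis
        by blast
    qed
  qed
  moreover have "U x = u i x" if "i \<in> A" "x \<in> range (p i)" for i x
  proof -
    have "x \<in> M"
      using that by (rule p_sub)
    have absorb: "p j x = (if j = i then x else 0)" if "j \<in> A" for j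
      using \<open>x \<in> range (p i)\<close> resolution_absorb[OF p that \<open>i \<in> A\<close>] by auto
    have u0: "u j 0 = 0" if "j \<in> A" for j
      using unitary_betweenD(2)[OF u[OF that], of "p j 0" 0] bounded_clinear_zero[OF resolutionD(2)[OF p that]]
      by simp
    have "U x = u i (p i x)"
      by (rule has_sum_only_one[OF U[OF \<open>x \<in> M\<close>] \<open>i \<in> A\<close>]) (simp add: absorb u0)
    then show ?thesis
      using absorb[OF \<open>i \<in> A\<close>] by simp
  qed
  ultimately show ?thesis
    unfolding unitary_between_def by blast
qed

section \<open>Orthonormal bases\<close>

definition orthonormal :: "'a::complex_inner set \<Rightarrow> bool" where
  "orthonormal B \<longleftrightarrow> (\<forall>x\<in>B. \<forall>y\<in>B. cinner x y = (if x = y then 1 else 0))"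

definition total_in :: "'a::complex_inner set \<Rightarrow> 'a set \<Rightarrow> bool" where
  "total_in M B \<longleftrightarrow> (\<forall>x\<in>M. (\<forall>b\<in>B. cinner b x = 0) \<longrightarrow> x = 0)"

lemma orthonormal_norm:
  assumes "orthonormal B" "b \<in> B"
  shows "norm b = 1"
proof -
  have "complex_of_real ((norm b)\<^sup>2) = complex_of_real 1"
    unfolding cinner_self[symmetric] using assms by (simp add: orthonormal_def)
  then have "(norm b)\<^sup>2 = 1"
    using of_real_eq_iff by blast
  then show ?thesis
    using norm_ge_zero[of b] by (simp add: power2_eq_1_iff)
qed

lemma orthonormal_orthogonal_family:
  assumes "orthonormal B"
  shows "orthogonal_family B (\<lambda>b. c b *\<^sub>C b)"
  using assms by (simp add: orthonormal_def orthogonal_family_def cinner_scaleC_left cinner_scaleC_right)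

lemma cinner_orthonormal_sum:
  assumes "orthonormal B" "finite F" "F \<subseteq> B" "b \<in> F"
  shows "cinner b (\<Sum>b\<in>F. c b *\<^sub>C b) = c b"
proof -
  have "cinner b (\<Sum>b\<in>F. c b *\<^sub>C b) = (\<Sum>a\<in>F. if a = b then c b else 0)"
    unfolding cinner_sum_right
  proof (rule sum.cong[OF refl])
    show "cinner b (c a *\<^sub>C a) = (if a = b then c b else 0)" if "a \<in> F" for a
      using assms that by (simp add: cinner_scaleC_right orthonormal_def subset_iff)
  qed
  then show ?thesis
    using assms by simp
qed

lemma orthonormal_sum_norm_square:
  assumes "orthonormal B" "finite F" "F \<subseteq> B"
  shows "(norm (\<Sum>b\<in>F. c b *\<^sub>C b))\<^sup>2 = (\<Sum>b\<in>F. (cmod (c b))\<^sup>2)"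
proof -
  have "(norm (\<Sum>b\<in>F. c b *\<^sub>C b))\<^sup>2 = (\<Sum>b\<in>F. (norm (c b *\<^sub>C b))\<^sup>2)"
    by (intro norm_sum_square_orthogonal assms(2)
        orthogonal_family_subset[OF orthonormal_orthogonal_family[OF assms(1)] assms(3)])
  also have "\<dots> = (\<Sum>b\<in>F. (cmod (c b))\<^sup>2)"
    by (rule sum.cong[OF refl]) (use assms(3) orthonormal_norm[OF assms(1)] in auto)
  finally show ?thesis .
qed

lemma Bessel_inequality:
  assumes "orthonormal B" "finite F" "F \<subseteq> B"
  shows "(\<Sum>b\<in>F. (cmod (cinner b x))\<^sup>2) \<le> (norm x)\<^sup>2"
proof -
  define y where "y = (\<Sum>b\<in>F. cinner b x *\<^sub>C b)"
  have "cinner b (x - y) = 0" if "b \<in> F" for b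
    unfolding y_def cinner_diff_right using cinner_orthonormal_sum[OF assms that] by simp
  then have "cinner y (x - y) = 0"
    by (subst y_def) (simp add: cinner_sum_left cinner_scaleC_left)
  from norm_add_square_orthogonal[OF this] have "(norm y)\<^sup>2 \<le> (norm x)\<^sup>2"
    by simp
  then show ?thesis
    unfolding y_def orthonormal_sum_norm_square[OF assms] .
qed

lemma orthonormal_summable:
  fixes B :: "'a::chilbert_space set"
  assumes "orthonormal B"
    and bound: "\<And>F. finite F \<Longrightarrow> F \<subseteq> B \<Longrightarrow> (\<Sum>b\<in>F. (cmod (c b))\<^sup>2) \<le> K"
  shows "(\<lambda>b. c b *\<^sub>C b) summable_on B"
proof (rule orthogonal_summable[OF orthonormal_orthogonal_family[OF assms(1)]])
  have "(\<lambda>b. (cmod (c b))\<^sup>2) summable_on B"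
    by (rule nonneg_bdd_above_summable_on) (auto intro!: bdd_aboveI[of _ K] bound)
  then show "(\<lambda>b. (norm (c b *\<^sub>C b))\<^sup>2) summable_on B"
    using orthonormal_norm[OF assms(1)] by (simp cong: summable_on_cong)
qed

lemma cinner_orthonormal_has_sum:
  assumes "orthonormal B" "((\<lambda>b. c b *\<^sub>C b) has_sum s) B" "b \<in> B"
  shows "cinner b s = c b"
proof -
  have "cinner b s = cinner b (c b *\<^sub>C b)"
    using assms by (intro cinner_has_sum_orthogonal[OF assms(2,3)])
      (simp add: cinner_scaleC_right orthonormal_def)
  then show ?thesis
    using assms by (simp add: cinner_scaleC_right orthonormal_def)
qed

lemma bounded_clinear_component: "bounded_clinear (\<lambda>x. cinner b x *\<^sub>C b)"
proof -
  have "norm (cinner b x *\<^sub>C b) \<le> (norm b * norm b) * norm x" for x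
    using mult_right_mono[OF Cauchy_Schwarz[of b x] norm_ge_zero[of b]] by (simp add: ac_simps)
  then show ?thesis
    unfolding bounded_clinear_iff
    by (auto simp: cinner_add_right cinner_scaleC_right scaleC_add_left scaleC_scaleC)
qed

text \<open>Bessel's inequality makes the expansion of \<open>x\<close> converge. What \<open>x\<close> and its expansion differ by
  is orthogonal to \<open>B\<close>, and totality forces it to vanish.\<close>

lemma orthonormal_resolution:
  fixes M :: "'a::chilbert_space set"
  assumes M: "closed_csubspace M" and "B \<subseteq> M" "orthonormal B" "total_in M B"
  shows "orthogonal_resolution M B (\<lambda>b x. cinner b x *\<^sub>C b)"
  unfolding orthogonal_resolution_def
proof (intro conjI ballI impI allI)
  show "((\<lambda>b. cinner b x *\<^sub>C b) has_sum x) B" if "x \<in> M" for x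
  proof -
    have "(\<lambda>b. cinner b x *\<^sub>C b) summable_on B"
      by (rule orthonormal_summable[OF assms(3) Bessel_inequality[OF assms(3)]])
    then obtain s where s: "((\<lambda>b. cinner b x *\<^sub>C b) has_sum s) B"
      by (auto simp: summable_on_def)
    have "s \<in> M"
      by (rule has_sum_in_closed_csubspace[OF M s]) (use assms(2) closed_csubspaceD(3)[OF M] in blast)
    moreover have "cinner b (x - s) = 0" if "b \<in> B" for b
      using cinner_orthonormal_has_sum[OF assms(3) s that] by (simp add: cinner_diff_right)
    ultimately have "x - s = 0"
      using assms(4) closed_csubspaceD(4)[OF M that] unfolding total_in_def by blast
    with s show ?thesis
      by simp
  qed
next
  fix b c x y assume "b \<in> B" "c \<in> B" "b \<noteq> c"
  then show "cinner (cinner b x *\<^sub>C b) (cinner c y *\<^sub>C c) = 0"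
    using assms(3) by (simp add: cinner_scaleC_left cinner_scaleC_right orthonormal_def)
next
  fix b assume "b \<in> B"
  then show "range (\<lambda>x. cinner b x *\<^sub>C b) \<subseteq> M"
    using assms(2) closed_csubspaceD(3)[OF M] by blast
qed (use M bounded_clinear_component in auto)

lemma subset_cspan: "B \<subseteq> cspan B"
  by (rule complex_vector.span_superset)

lemma total_imp_orthonormal_basis:
  fixes M :: "'a::chilbert_space set"
  assumes M: "closed_csubspace M" and B: "B \<subseteq> M" "orthonormal B" "total_in M B"
  shows "orthonormal_basis M B"
proof -
  have "closure (cspan B) \<subseteq> M"
    using M B(1) complex_vector.span_minimal unfolding closed_csubspace_def
    by (intro closure_minimal) auto
  moreover have "x \<in> closure (cspan B)" if "x \<in> M" for x
  proof (rule Lim_in_closed_set)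
    show "(sum (\<lambda>b. cinner b x *\<^sub>C b) \<longlongrightarrow> x) (finite_subsets_at_top B)"
      using resolutionD(5)[OF orthonormal_resolution[OF assms] that] by (simp add: has_sum_def)
    have "sum (\<lambda>b. cinner b x *\<^sub>C b) F \<in> closure (cspan B)" if "F \<subseteq> B" for F
      by (rule subsetD[OF closure_subset complex_vector.span_sum[OF complex_vector.span_scale]])
         (use that subset_cspan in blast)
    then show "\<forall>\<^sub>F F in finite_subsets_at_top B. sum (\<lambda>b. cinner b x *\<^sub>C b) F \<in> closure (cspan B)"
      by (simp add: eventually_finite_subsets_at_top_weakI)
  qed simp_all
  ultimately show ?thesis
    using B(2) unfolding orthonormal_basis_def orthonormal_def by blast
qed

lemma orthonormal_basisD:
  assumes "orthonormal_basis M B"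
  shows "orthonormal B" and "B \<subseteq> M" and "total_in M B"
proof -
  show "orthonormal B"
    using assms by (simp add: orthonormal_basis_def orthonormal_def)
  have M: "closure (cspan B) = M"
    using assms by (simp add: orthonormal_basis_def)
  then show "B \<subseteq> M"
    using subset_cspan closure_subset by blast
  show "total_in M B"
    unfolding total_in_def
  proof (intro ballI impI)
    fix x assume x: "x \<in> M" "\<forall>b\<in>B. cinner b x = 0"
    have "cspan B \<subseteq> {y. cinner y x = 0}"
      using x by (intro complex_vector.span_minimal)
        (auto simp: complex_vector.subspace_def cinner_add_left cinner_scaleC_left)
    moreover have "closed {y. cinner y x = 0}"
      by (intro closed_Collect_eq continuous_on_cinner continuous_on_const continuous_on_id)
    ultimately have "M \<subseteq> {y. cinner y x = 0}"
      using closure_minimal M by blast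
    then show "x = 0"
      using x by auto
  qed
qed

text \<open>A maximal orthonormal subset is total: a nonzero vector of \<open>M\<close> orthogonal to all of it could
  be normalized and added.\<close>

lemma orthonormal_basis_exists:
  fixes M :: "'a::chilbert_space set"
  assumes M: "closed_csubspace M"
  shows "\<exists>B. orthonormal_basis M B"
proof -
  let ?\<B> = "{B. B \<subseteq> M \<and> orthonormal B}"
  have "\<exists>B\<in>?\<B>. \<forall>C\<in>?\<B>. B \<subseteq> C \<longrightarrow> C = B"
  proof (rule subset_Zorn')
    fix C assume "subset.chain ?\<B> C"
    then have C: "C \<subseteq> ?\<B>" and chain: "\<And>A B. A \<in> C \<Longrightarrow> B \<in> C \<Longrightarrow> A \<subseteq> B \<or> B \<subseteq> A"
      by (auto simp: subset_chain_def)
    have "cinner x y = (if x = y then 1 else 0)" if xy: "x \<in> \<Union>C" "y \<in> \<Union>C" for x y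
    proof -
      obtain A B where "x \<in> A" "A \<in> C" "y \<in> B" "B \<in> C"
        using xy by blast
      with chain obtain D where "D \<in> C" "x \<in> D" "y \<in> D"
        by (meson subsetD)
      with C show ?thesis
        by (auto simp: orthonormal_def)
    qed
    then have "orthonormal (\<Union>C)"
      unfolding orthonormal_def by blast
    moreover have "\<Union>C \<subseteq> M"
      using C by blast
    ultimately show "\<Union>C \<in> ?\<B>"
      by simp
  qed
  then obtain B where "B \<in> ?\<B>" and max': "\<forall>C\<in>?\<B>. B \<subseteq> C \<longrightarrow> C = B"
    by (rule bexE)
  then have B: "B \<subseteq> M" "orthonormal B"
    by simp_all
  have max: "C = B" if "C \<subseteq> M" "orthonormal C" "B \<subseteq> C" for C
    using max' that by simp
  have "total_in M B"
    unfolding total_in_def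
  proof (intro ballI impI, rule ccontr)
    fix x assume x: "x \<in> M" "\<forall>b\<in>B. cinner b x = 0" "x \<noteq> 0"
    define e where "e = complex_of_real (1 / norm x) *\<^sub>C x"
    have "cinner e e = complex_of_real ((norm e)\<^sup>2)"
      by (rule cinner_self)
    also have "norm e = 1"
      using x by (simp add: e_def norm_divide)
    finally have "cinner e e = 1"
      by simp
    moreover have right: "cinner b e = 0" if "b \<in> B" for b
      using x that by (simp add: e_def cinner_scaleC_right)
    moreover have "cinner e b = 0" if "b \<in> B" for b
      using right[OF that] cinner_eq_0_commute by blast
    ultimately have "orthonormal (insert e B)" and "e \<notin> B"
      using B(2) by (auto simp: orthonormal_def)
    moreover have "insert e B \<subseteq> M"
      using B(1) closed_csubspaceD(3)[OF M x(1)] by (simp add: e_def)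
    ultimately show False
      using max by blast
  qed
  then show ?thesis
    using total_imp_orthonormal_basis[OF M B] by blast
qed

section \<open>Adjoints\<close>

definition is_adjoint :: "('a::complex_inner \<Rightarrow> 'b::complex_inner) \<Rightarrow> ('b \<Rightarrow> 'a) \<Rightarrow> bool" where
  "is_adjoint T T' \<longleftrightarrow> (\<forall>x y. cinner (T x) y = cinner x (T' y))"

text \<open>Adjoints are unique, so exhibiting one identifies the operator chosen by \<open>cadjoint\<close>.\<close>

lemma is_adjoint_imp_cadjoint:
  assumes "is_adjoint T T'"
  shows "cadjoint T = T'"
  unfolding cadjoint_def
proof (rule some_equality)
  show "\<forall>x y. cinner (T x) y = cinner x (T' y)"
    using assms by (simp add: is_adjoint_def)
  show "T'' = T'" if "\<forall>x y. cinner (T x) y = cinner x (T'' y)" for T''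
    using that assms by (intro ext cinner_ext) (simp add: is_adjoint_def)
qed

text \<open>An orthonormal basis \<open>B\<close> replaces the Riesz representation theorem. The coefficients of the
  adjoint at \<open>y\<close> have to be \<open>cinner (T b) y\<close>. They are square summable because the finite sum
  \<open>w\<close> with these coefficients satisfies \<open>cinner (T w) y = (norm w)\<^sup>2\<close>, so that boundedness of
  \<open>T\<close> yields \<open>norm w \<le> C * norm y\<close>.\<close>

lemma adjoint_exists:
  fixes T :: "'a::chilbert_space \<Rightarrow> 'b::complex_inner"
  assumes T: "bounded_clinear T"
  shows "\<exists>T'. is_adjoint T T'"
proof -
  obtain B :: "'a set" where "orthonormal_basis UNIV B"
    using orthonormal_basis_exists closed_csubspace_UNIV by blast
  note B = orthonormal_basisD[OF this]
  obtain C where C: "\<And>x. norm (T x) \<le> C * norm x"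
    using T by (auto simp: bounded_clinear_iff)
  have sumT: "T (\<Sum>b\<in>F. c b *\<^sub>C b) = (\<Sum>b\<in>F. c b *\<^sub>C T b)" for F c
    by (subst linear_sum[OF bounded_linear.linear[OF bounded_clinear_bounded_linear[OF T]]])
       (simp add: bounded_clinear_scaleC[OF T])
  have "\<exists>z. \<forall>x. cinner (T x) y = cinner x z" for y
  proof -
    define c where "c b = cinner (T b) y" for b
    have "(\<Sum>b\<in>F. (cmod (c b))\<^sup>2) \<le> (C * norm y)\<^sup>2" if F: "finite F" "F \<subseteq> B" for F
    proof -
      define w where "w = (\<Sum>b\<in>F. c b *\<^sub>C b)"
      have "cinner (T w) y = (\<Sum>b\<in>F. cnj (c b) * c b)"
        unfolding w_def sumT by (simp add: cinner_sum_left cinner_scaleC_left c_def)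
      also have "\<dots> = (\<Sum>b\<in>F. complex_of_real ((cmod (c b))\<^sup>2))"
        by (intro sum.cong refl) (simp only: complex_norm_square mult.commute)
      also have "\<dots> = complex_of_real ((norm w)\<^sup>2)"
        unfolding w_def orthonormal_sum_norm_square[OF B(1) F] by simp
      finally have "(norm w)\<^sup>2 = cmod (cinner (T w) y)"
        by (simp del: of_real_power)
      also have "\<dots> \<le> norm (T w) * norm y"
        by (rule Cauchy_Schwarz)
      also have "\<dots> \<le> (C * norm w) * norm y"
        using C by (intro mult_right_mono) auto
      finally have "norm w * norm w \<le> norm w * (C * norm y)"
        by (simp add: power2_eq_square ac_simps)
      then have "norm w \<le> \<bar>C * norm y\<bar>"
        by (cases "w = 0") (auto simp: mult_le_cancel_left_pos)
      then have "(norm w)\<^sup>2 \<le> (C * norm y)\<^sup>2"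
        using abs_le_square_iff[of "norm w" "C * norm y"] by simp
      then show ?thesis
        unfolding w_def orthonormal_sum_norm_square[OF B(1) F] .
    qed
    from orthonormal_summable[OF B(1) this]
    obtain z where z: "((\<lambda>b. c b *\<^sub>C b) has_sum z) B"
      by (auto simp: summable_on_def)
    have "cinner (T x) y = cinner x z" for x
    proof (rule has_sum_unique)
      have x: "((\<lambda>b. cinner b x *\<^sub>C b) has_sum x) B"
        using resolutionD(5)[OF orthonormal_resolution[OF closed_csubspace_UNIV subset_UNIV B(1,3)]] by simp
      from has_sum_cinner_left[OF this, of z]
      show "((\<lambda>b. cnj (cinner b x) * c b) has_sum cinner x z) B"
        using cinner_orthonormal_has_sum[OF B(1) z] by (simp add: cinner_scaleC_left cong: has_sum_cong)
      from has_sum_cinner_left[OF has_sum_bounded_linear[OF bounded_clinear_bounded_linear[OF T] x], of y]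
      show "((\<lambda>b. cnj (cinner b x) * c b) has_sum cinner (T x) y) B"
        by (simp add: bounded_clinear_scaleC[OF T] cinner_scaleC_left c_def)
    qed
    then show ?thesis
      by blast
  qed
  then have "\<forall>y. \<exists>z. \<forall>x. cinner (T x) y = cinner x z"
    by blast
  from choice[OF this] show ?thesis
    unfolding is_adjoint_def by blast
qed

lemma is_adjoint_cadjoint:
  fixes T :: "'a::chilbert_space \<Rightarrow> 'b::complex_inner"
  assumes "bounded_clinear T"
  shows "is_adjoint T (cadjoint T)"
proof -
  obtain T' where T': "is_adjoint T T'"
    using adjoint_exists[OF assms] by blast
  then show ?thesis
    by (simp only: is_adjoint_imp_cadjoint[OF T'])
qed

lemma is_adjoint_compose:
  "is_adjoint T T' \<Longrightarrow> is_adjoint U U' \<Longrightarrow> is_adjoint (T \<circ> U) (U' \<circ> T')"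
  unfolding is_adjoint_def by simp

lemma adjoint_bounded_clinear:
  assumes adj: "is_adjoint T T'" and T: "bounded_clinear T"
  shows "bounded_clinear T'"
proof -
  have adj': "cinner x (T' y) = cinner (T x) y" for x y
    using adj by (simp add: is_adjoint_def)
  obtain C where "C \<ge> 0" and bound: "\<forall>x. norm (T x) \<le> norm x * C"
    using bounded_linear.nonneg_bounded[OF bounded_clinear_bounded_linear[OF T]] by blast
  have C: "norm (T x) \<le> C * norm x" for x
    using bound by (simp only: mult.commute)
  have "norm (T' y) \<le> C * norm y" for y
  proof (cases "T' y = 0")
    case False
    have "norm (T' y) * norm (T' y) = cmod (cinner (T' y) (T' y))"
      by (simp add: cinner_self norm_power power2_eq_square norm_mult)
    also have "\<dots> = cmod (cinner (T (T' y)) y)"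
      by (simp add: adj')
    also have "\<dots> \<le> norm (T (T' y)) * norm y"
      by (rule Cauchy_Schwarz)
    also have "\<dots> \<le> (C * norm (T' y)) * norm y"
      using C by (intro mult_right_mono) auto
    finally have "norm (T' y) * norm (T' y) \<le> norm (T' y) * (C * norm y)"
      by (simp add: ac_simps)
    then show ?thesis
      using False by (simp add: mult_le_cancel_left_pos)
  qed (use \<open>C \<ge> 0\<close> in simp)
  moreover have "T' (x + y) = T' x + T' y" for x y
    by (rule cinner_ext) (simp add: adj' cinner_add_right)
  moreover have "T' (c *\<^sub>C x) = c *\<^sub>C T' x" for c x
    by (rule cinner_ext) (simp add: adj' cinner_scaleC_right)
  ultimately show ?thesis
    unfolding bounded_clinear_iff by blast
qed

section \<open>Hilbert dimension\<close>

lemma orthonormal_basis_expansion: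
  fixes M :: "'a::chilbert_space set"
  assumes "closed_csubspace M" "orthonormal_basis M B" "x \<in> M"
  shows "((\<lambda>b. cinner b x *\<^sub>C b) has_sum x) B"
  using resolutionD(5)[OF orthonormal_resolution[OF assms(1)] assms(3)] orthonormal_basisD[OF assms(2)]
  by blast

lemma Parseval:
  fixes M :: "'a::chilbert_space set"
  assumes "closed_csubspace M" "orthonormal_basis M B" "x \<in> M"
  shows "((\<lambda>b. (cmod (cinner b x))\<^sup>2) has_sum (norm x)\<^sup>2) B"
proof -
  note B = orthonormal_basisD(1)[OF assms(2)]
  have "((\<lambda>b. (norm (cinner b x *\<^sub>C b))\<^sup>2) has_sum (norm x)\<^sup>2) B"
    by (rule orthogonal_has_sum_norm_square[OF orthonormal_orthogonal_family[OF B]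
          orthonormal_basis_expansion[OF assms]])
  then show ?thesis
    using orthonormal_norm[OF B] by (simp cong: has_sum_cong)
qed

lemma cmod_cinner_commute: "cmod (cinner x y) = cmod (cinner y x)"
  by (subst cinner_commute) simp

text \<open>Count \<open>(\<Sum>f. \<Sum>b. (cmod (cinner b f))\<^sup>2)\<close> in two ways: summing over the basis \<open>B\<close> first gives
  \<open>1\<close> for each \<open>f\<close> by Parseval, summing over \<open>F\<close> first gives at most \<open>1\<close> for each \<open>b\<close> by Bessel.\<close>

lemma orthonormal_card_le_finite_basis:
  fixes M :: "'a::chilbert_space set"
  assumes M: "closed_csubspace M" and B: "orthonormal_basis M B" "finite B"
    and F: "orthonormal F" "finite F" "F \<subseteq> M"
  shows "card F \<le> card B"
proof -
  have "real (card F) = (\<Sum>f\<in>F. (norm f)\<^sup>2)"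
    by (simp add: orthonormal_norm[OF F(1)])
  also have "\<dots> = (\<Sum>f\<in>F. \<Sum>b\<in>B. (cmod (cinner b f))\<^sup>2)"
  proof (rule sum.cong[OF refl])
    show "(norm f)\<^sup>2 = (\<Sum>b\<in>B. (cmod (cinner b f))\<^sup>2)" if "f \<in> F" for f
      using Parseval[OF M B(1)] that F(3) B(2) has_sum_finite_iff by blast
  qed
  also have "\<dots> = (\<Sum>b\<in>B. \<Sum>f\<in>F. (cmod (cinner f b))\<^sup>2)"
    by (subst sum.swap) (simp add: cmod_cinner_commute)
  also have "\<dots> \<le> (\<Sum>b\<in>B. (norm b)\<^sup>2)"
    by (intro sum_mono Bessel_inequality[OF F(1,2)] order_refl)
  also have "\<dots> = real (card B)"
    by (simp add: orthonormal_norm[OF orthonormal_basisD(1)[OF B(1)]])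
  finally show ?thesis
    by simp
qed

text \<open>For infinite \<open>B\<close>, each element of \<open>B\<close> is orthogonal to all but countably many elements of
  \<open>B'\<close>, and no element of \<open>B'\<close> is orthogonal to all of \<open>B\<close>. So \<open>B'\<close> is a union of countable
  sets indexed by \<open>B\<close>.\<close>

lemma orthonormal_bases_card_le:
  fixes M :: "'a::chilbert_space set"
  assumes M: "closed_csubspace M" and B: "orthonormal_basis M B" and B': "orthonormal_basis M B'"
  shows "(card_of B', card_of B) \<in> ordLeq"
proof (cases "finite B")
  case True
  note o = orthonormal_basisD[OF B']
  have le: "card F \<le> card B" if "finite F" "F \<subseteq> B'" for F
    using orthonormal_card_le_finite_basis[OF M B True, of F] o that by (auto simp: orthonormal_def subset_iff)
  have "finite B'"
  proof (rule ccontr)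
    assume "infinite B'"
    then obtain F where "F \<subseteq> B'" "finite F" "card F = Suc (card B)"
      using infinite_arbitrarily_large by blast
    with le[of F] show False
      by simp
  qed
  with le[of B'] True obtain f where "inj_on f B'" "f ` B' \<subseteq> B"
    using inj_on_iff_card_le by blast
  then show ?thesis
    using card_of_ordLeq by blast
next
  case False
  define meets where "meets b = {c \<in> B'. cinner c b \<noteq> 0}" for b
  note o = orthonormal_basisD[OF B] and o' = orthonormal_basisD[OF B']
  have "(card_of (\<Union>b\<in>B. meets b), card_of B) \<in> ordLeq"
  proof (rule card_of_UNION_ordLeq_infinite[OF False card_of_refl[THEN ordIso_imp_ordLeq]], intro ballI)
    fix b assume "b \<in> B"
    then have "(\<lambda>c. (cmod (cinner c b))\<^sup>2) summable_on B'"
      using Parseval[OF M B'] o(2) by (blast intro: has_sum_imp_summable)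
    then have "countable {c \<in> B'. (cmod (cinner c b))\<^sup>2 \<noteq> 0}"
      by (rule summable_countable_real)
    then have "countable (meets b)"
      by (simp add: meets_def)
    then have "(card_of (meets b), card_of (UNIV::nat set)) \<in> ordLeq"
      unfolding countable_def card_of_ordLeq[symmetric] by blast
    then show "(card_of (meets b), card_of B) \<in> ordLeq"
      using False infinite_iff_card_of_nat ordLeq_transitive by blast
  qed
  moreover have "B' \<subseteq> (\<Union>b\<in>B. meets b)"
  proof
    fix c assume c: "c \<in> B'"
    then have "c \<noteq> 0"
      using orthonormal_norm[OF o'(1)] by force
    then obtain b where "b \<in> B" "cinner b c \<noteq> 0"
      using o(3) o'(2) c unfolding total_in_def by blast
    then show "c \<in> (\<Union>b\<in>B. meets b)"
      using c cinner_eq_0_commute by (auto simp: meets_def)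
  qed
  ultimately show ?thesis
    using card_of_mono1 ordLeq_transitive by blast
qed

lemma unitary_between_inj:
  assumes "unitary_between M M' U"
  shows "inj_on U M"
proof (rule inj_onI)
  fix x y assume xy: "x \<in> M" "y \<in> M" and "U x = U y"
  note U = unitary_betweenD(3)[OF assms]
  have "cinner (x - y) (x - y) = cinner (U x - U y) (U x - U y)"
    unfolding cinner_diff_left cinner_diff_right U[OF xy(1,1)] U[OF xy(1,2)] U[OF xy(2,1)] U[OF xy(2,2)] ..
  then show "x = y"
    using \<open>U x = U y\<close> by simp
qed

lemma unitary_image_basis:
  fixes M :: "'a::complex_inner set" and M' :: "'b::chilbert_space set"
  assumes U: "unitary_between M M' U" and M': "closed_csubspace M'" and B: "orthonormal_basis M B"
  shows "orthonormal_basis M' (U ` B)"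
proof (rule total_imp_orthonormal_basis[OF M'])
  note o = orthonormal_basisD[OF B]
  show "U ` B \<subseteq> M'"
    using unitary_betweenD(5)[OF U] o(2) by blast
  show "orthonormal (U ` B)"
    using o(1,2) unitary_betweenD(3)[OF U] unitary_between_inj[OF U]
    unfolding orthonormal_def by (auto simp: subset_iff inj_on_def)
  show "total_in M' (U ` B)"
    unfolding total_in_def
  proof (intro ballI impI)
    fix y assume y: "y \<in> M'" "\<forall>b\<in>U ` B. cinner b y = 0"
    then obtain x where x: "x \<in> M" "y = U x"
      using unitary_betweenD(4)[OF U] by blast
    then have "cinner b x = 0" if "b \<in> B" for b
      using y(2) that o(2) unitary_betweenD(3)[OF U] by fastforce
    then have "x = 0"
      using o(3) x(1) unfolding total_in_def by blast
    then show "y = 0"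
      using unitary_between_norm[OF U x(1)] x(2) by simp
  qed
qed

lemma unitary_between_span_singleton:
  assumes "orthonormal B" "b \<in> B" "orthonormal B'" "b' \<in> B'"
  shows "unitary_between (range (\<lambda>x. cinner b x *\<^sub>C b)) (range (\<lambda>x. cinner b' x *\<^sub>C b'))
    (\<lambda>x. cinner b x *\<^sub>C b')"
proof -
  have range: "range (\<lambda>x. cinner b x *\<^sub>C b) = range (\<lambda>c. c *\<^sub>C b)" if "cinner b b = 1" for b :: "'c::complex_inner"
  proof (intro equalityI subsetI)
    fix y assume "y \<in> range (\<lambda>c. c *\<^sub>C b)"
    then obtain c where "y = cinner b (c *\<^sub>C b) *\<^sub>C b"
      using \<open>cinner b b = 1\<close> by (auto simp: cinner_scaleC_right)
    then show "y \<in> range (\<lambda>x. cinner b x *\<^sub>C b)"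
      by blast
  qed blast
  have b: "cinner b b = 1" "cinner b' b' = 1"
    using assms by (simp_all add: orthonormal_def)
  show ?thesis
    unfolding range[OF b(1)] range[OF b(2)] unitary_between_def
    using b by (auto simp: cinner_add_right cinner_scaleC_right cinner_scaleC_left scaleC_add_left
        scaleC_scaleC image_image)
qed

text \<open>A bijection between bases gives unitary maps between the lines that they span, which glue.
  Conversely, a unitary map takes a basis to a basis, which has the cardinality of any other.\<close>

theorem same_hilbert_dim_iff_unitary:
  fixes M :: "'a::chilbert_space set" and M' :: "'b::chilbert_space set"
  assumes M: "closed_csubspace M" and M': "closed_csubspace M'"
  shows "same_hilbert_dim M M' \<longleftrightarrow> (\<exists>U. unitary_between M M' U)"
proof -
  define B where "B = (SOME B. orthonormal_basis M B)"
  define B' where "B' = (SOME B. orthonormal_basis M' B)"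
  have B: "orthonormal_basis M B"
    unfolding B_def using someI_ex[OF orthonormal_basis_exists[OF M]] .
  have B': "orthonormal_basis M' B'"
    unfolding B'_def using someI_ex[OF orthonormal_basis_exists[OF M']] .
  note o = orthonormal_basisD[OF B] and o' = orthonormal_basisD[OF B']
  have dim: "same_hilbert_dim M M' \<longleftrightarrow> (card_of B, card_of B') \<in> ordIso"
    by (simp add: same_hilbert_dim_def hilbert_dim_def B_def B'_def)
  show ?thesis
  proof
    assume "same_hilbert_dim M M'"
    then obtain f where f: "bij_betw f B B'"
      unfolding dim card_of_ordIso[symmetric] by blast
    have res: "orthogonal_resolution M' B (\<lambda>b x. cinner (f b) x *\<^sub>C f b)"
      by (rule resolution_reindex[OF orthonormal_resolution[OF M' o'(2,1,3)] f])
    have "unitary_between (range (\<lambda>x. cinner b x *\<^sub>C b)) (range (\<lambda>x. cinner (f b) x *\<^sub>C f b))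
        (\<lambda>x. cinner b x *\<^sub>C f b)" if "b \<in> B" for b
      by (rule unitary_between_span_singleton[OF o(1) that o'(1)]) (use f that in \<open>auto simp: bij_betw_def\<close>)
    from unitary_glue[OF orthonormal_resolution[OF M o(2,1,3)] res this]
    show "\<exists>U. unitary_between M M' U"
      by blast
  next
    assume "\<exists>U. unitary_between M M' U"
    then obtain U where U: "unitary_between M M' U"
      by blast
    have "bij_betw U B (U ` B)"
      using unitary_between_inj[OF U] o(2) by (meson bij_betw_def inj_on_subset)
    then have "(card_of B, card_of (U ` B)) \<in> ordIso"
      using card_of_ordIso by blast
    moreover have "(card_of (U ` B), card_of B') \<in> ordIso"
      using orthonormal_bases_card_le[OF M'] unitary_image_basis[OF U M' B] B' ordIso_iff_ordLeq by blast
    ultimately show "same_hilbert_dim M M'"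
      unfolding dim by (rule ordIso_transitive)
  qed
qed

section \<open>Infinite words\<close>

lemma inf_words_build [simp]: "i ## \<omega> \<in> inf_words N \<longleftrightarrow> i < N \<and> \<omega> \<in> inf_words N"
proof -
  have "(\<forall>n. (i ## \<omega>) n < N) \<longleftrightarrow> (\<forall>a\<in>range (i ## \<omega>). a < N)"
    by blast
  then show ?thesis
    by (auto simp: inf_words_def)
qed

lemma inf_words_conc [simp]: "I \<frown> \<omega> \<in> inf_words N \<longleftrightarrow> set I \<subseteq> {..<N} \<and> \<omega> \<in> inf_words N"
  by (induction I) auto

lemma inf_words_suffix: "\<omega> \<in> inf_words N \<Longrightarrow> suffix k \<omega> \<in> inf_words N"
  by (simp add: inf_words_def)

lemma set_prefix_inf_words: "\<omega> \<in> inf_words N \<Longrightarrow> set (prefix k \<omega>) \<subseteq> {..<N}"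
  by (auto simp: inf_words_def)

lemma shift_funpow: "(shift ^^ p) \<omega> = suffix p \<omega>"
  by (induction p) (simp_all add: shift_def fun_eq_iff)

lemma is_cycle_iff_suffix: "is_cycle \<omega> \<longleftrightarrow> (\<exists>p>0. suffix p \<omega> = \<omega>)"
  by (simp add: is_cycle_def shift_funpow)

lemma suffix_Suc_build [simp]: "suffix (Suc m) (i ## \<omega>) = suffix m \<omega>"
  by (simp add: fun_eq_iff)

lemma prefix_Suc_build: "prefix (Suc n) (i ## \<omega>) = i # prefix n \<omega>"
  by (rule nth_equalityI) (auto simp: nth_Cons less_Suc_eq_0_disj simp del: subseq_to_Suc split: nat.splits)

lemma prefix_add: "prefix (m + k) \<omega> = prefix m \<omega> @ prefix k (suffix m \<omega>)"
  by (simp add: subsequence_append)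

lemma suffix_period_iter:
  assumes "suffix p \<omega> = \<omega>" "p > 0"
  shows "\<omega> = (prefix p \<omega>)\<^sup>\<omega>"
proof
  fix n
  show "\<omega> n = (prefix p \<omega>)\<^sup>\<omega> n"
  proof (induction n rule: less_induct)
    case (less n)
    show ?case
    proof (cases "n < p")
      case False
      have "\<omega> n = suffix p \<omega> (n - p)"
        using False by simp
      also have "\<dots> = (prefix p \<omega>)\<^sup>\<omega> (n - p)"
        using less.IH[of "n - p"] assms False by simp
      finally show ?thesis
        using False assms(2) by (simp add: le_mod_geq)
    qed (use assms(2) in simp)
  qed
qed

definition tail_equivalent :: "(nat \<Rightarrow> nat) \<Rightarrow> (nat \<Rightarrow> nat) \<Rightarrow> bool" where
  "tail_equivalent \<omega> \<zeta> \<longleftrightarrow> (\<exists>m n. suffix m \<omega> = suffix n \<zeta>)"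

lemma tail_equivalent_refl: "tail_equivalent \<omega> \<omega>"
  by (auto simp: tail_equivalent_def)

lemma tail_equivalent_sym: "tail_equivalent \<omega> \<zeta> \<Longrightarrow> tail_equivalent \<zeta> \<omega>"
  unfolding tail_equivalent_def by metis

lemma tail_equivalent_trans:
  assumes "tail_equivalent \<omega> \<zeta>" "tail_equivalent \<zeta> \<eta>"
  shows "tail_equivalent \<omega> \<eta>"
proof -
  obtain m n k l where eq: "suffix m \<omega> = suffix n \<zeta>" "suffix k \<zeta> = suffix l \<eta>"
    using assms unfolding tail_equivalent_def by blast
  have "suffix (m + k) \<omega> = suffix k (suffix n \<zeta>)"
    by (simp flip: eq(1))
  also have "\<dots> = suffix n (suffix k \<zeta>)"
    by (simp add: add.commute)
  also have "\<dots> = suffix (l + n) \<eta>"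
    by (simp add: eq(2))
  finally show ?thesis
    unfolding tail_equivalent_def by blast
qed

lemma tail_equivalent_build: "tail_equivalent (i ## \<omega>) \<omega>"
  unfolding tail_equivalent_def by (intro exI[of _ 1] exI[of _ 0]) simp

lemma tail_equivalent_suffix: "tail_equivalent (suffix k \<omega>) \<omega>"
  unfolding tail_equivalent_def by (intro exI[of _ 0] exI[of _ k]) simp

text \<open>The least positive period of a cycle; written with \<open>Suc\<close> so that it is positive for every
  word.\<close>

definition period :: "(nat \<Rightarrow> nat) \<Rightarrow> nat" where
  "period \<omega> = Suc (LEAST m. suffix (Suc m) \<omega> = \<omega>)"

lemma suffix_period: "is_cycle \<omega> \<Longrightarrow> suffix (period \<omega>) \<omega> = \<omega>"
  unfolding period_def is_cycle_iff_suffix by (metis (mono_tags, lifting) LeastI gr0_implies_Suc)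

text \<open>Moving on from a common tail to the next multiple of the period of \<open>r\<close> leads back to \<open>r\<close> itself.\<close>

lemma tail_equivalent_cycle:
  assumes "is_cycle r" "tail_equivalent \<omega> r"
  shows "\<exists>m. suffix m \<omega> = r"
proof -
  obtain m n where mn: "suffix m \<omega> = suffix n r"
    using assms(2) by (auto simp: tail_equivalent_def)
  obtain p where p: "p > 0" "suffix p r = r"
    using assms(1) by (auto simp: is_cycle_iff_suffix)
  have "suffix (k * p) r = r" for k
  proof (induction k)
    case (Suc k)
    have "suffix (Suc k * p) r = suffix (k * p) (suffix p r)"
      by simp
    with Suc p(2) show ?case
      by simp
  qed simp
  then have "suffix (n * p) r = r" .
  moreover have "n \<le> n * p"
    using p(1) by simp
  moreover have "suffix (m + (n * p - n)) \<omega> = suffix (n * p - n) (suffix n r)"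
    unfolding mn[symmetric] by simp
  ultimately have "suffix (m + (n * p - n)) \<omega> = r"
    by simp
  then show ?thesis ..
qed

section \<open>Projection valued measures\<close>

lemma pvmD:
  assumes "projection_valued_measure M P" "E \<in> sets M"
  shows "bounded_clinear (P E)" and "P E (P E x) = P E x" and "is_adjoint (P E) (P E)"
    and "F \<in> sets M \<Longrightarrow> P (E \<inter> F) x = P E (P F x)" and "P {} x = 0"
proof -
  have op: "orthogonal_projection (P E)"
    using assms by (simp add: projection_valued_measure_def)
  then show "bounded_clinear (P E)" "P E (P E x) = P E x"
    by (auto simp: orthogonal_projection_def fun_eq_iff)
  then show "is_adjoint (P E) (P E)"
    using op is_adjoint_cadjoint[of "P E"] by (simp add: orthogonal_projection_def)
  show "F \<in> sets M \<Longrightarrow> P (E \<inter> F) x = P E (P F x)" "P {} x = 0"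
    using assms by (auto simp: projection_valued_measure_def)
qed

lemma pvm_countably_additive:
  assumes "projection_valued_measure M P" "range A \<subseteq> sets M" "disjoint_family A"
  shows "(\<lambda>n. P (A n) x) sums P (\<Union>n. A n) x"
  using assms by (simp add: projection_valued_measure_def)

lemma pvm_additive:
  assumes P: "projection_valued_measure M P" and EF: "E \<in> sets M" "F \<in> sets M" "E \<inter> F = {}"
  shows "P (E \<union> F) x = P E x + P F x"
proof -
  let ?A = "\<lambda>n::nat. if n = 0 then E else if n = 1 then F else {}"
  have "(\<lambda>n. P (?A n) x) sums P (\<Union>n. ?A n) x"
    using EF by (intro pvm_countably_additive[OF P]) (auto simp: disjoint_family_on_def)
  moreover have "(\<lambda>n. P (?A n) x) sums (\<Sum>n\<in>{0, 1}. P (?A n) x)"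
    by (rule sums_finite) (auto simp: pvmD(5)[OF P EF(1)])
  moreover have "(\<Union>n. ?A n) = E \<union> F"
    by (auto split: if_splits)
  ultimately show ?thesis
    using sums_unique2 by fastforce
qed

text \<open>\<open>A 0\<close> is the disjoint union of the intersection and of the differences of consecutive
  sets, and the series of the values on the differences telescopes.\<close>

lemma pvm_continuous_from_above:
  assumes P: "projection_valued_measure M P" and A: "range A \<subseteq> sets M" "decseq A"
  shows "(\<lambda>n. P (A n) x) \<longlonglongrightarrow> P (\<Inter>n. A n) x"
proof -
  define C where "C n = A n - A (Suc n)" for n
  have meas: "A n \<in> sets M" "C n \<in> sets M" "(\<Inter>n. A n) \<in> sets M" for n
    using A(1) by (auto simp: C_def)
  have step: "P (C n) x = P (A n) x - P (A (Suc n)) x" for n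
  proof -
    have "C n \<union> A (Suc n) = A n"
      using A(2) unfolding C_def decseq_Suc_iff by blast
    moreover have "P (C n \<union> A (Suc n)) x = P (C n) x + P (A (Suc n)) x"
      by (rule pvm_additive[OF P meas(2) meas(1)]) (auto simp: C_def)
    ultimately show ?thesis
      by simp
  qed
  have "disjoint_family C"
    unfolding disjoint_family_on_def
  proof (intro ballI impI)
    fix m n :: nat assume "m \<noteq> n"
    then consider "Suc m \<le> n" | "Suc n \<le> m"
      by linarith
    then show "C m \<inter> C n = {}"
      using A(2) by cases (auto simp: C_def dest!: decseqD)
  qed
  then have "(\<lambda>n. P (C n) x) sums P (\<Union>n. C n) x"
    using meas by (intro pvm_countably_additive[OF P]) auto
  moreover have "(\<Sum>k<n. P (C k) x) = P (A 0) x - P (A n) x" for n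
    unfolding step by (rule sum_lessThan_telescope')
  moreover have "P (A 0) x = P (\<Union>n. C n) x + P (\<Inter>n. A n) x"
  proof -
    have "z \<in> (\<Union>n. C n)" if z: "z \<in> A 0" "z \<notin> (\<Inter>n. A n)" for z
    proof (rule ccontr)
      assume no: "z \<notin> (\<Union>n. C n)"
      have "z \<in> A n" for n
        by (induction n) (use z no in \<open>auto simp: C_def\<close>)
      with z show False
        by blast
    qed
    moreover have "(\<Union>n. C n) \<subseteq> A 0"
      using A(2) by (auto simp: C_def dest: decseqD)
    ultimately have "A 0 = (\<Union>n. C n) \<union> (\<Inter>n. A n)"
      by blast
    moreover have "(\<Union>n. C n) \<inter> (\<Inter>n. A n) = {}"
      by (auto simp: C_def)
    ultimately show ?thesis
      using pvm_additive[OF P, of "\<Union>n. C n" "\<Inter>n. A n" x] meas by auto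
  qed
  ultimately have "(\<lambda>n. P (A 0) x - P (A n) x) \<longlonglongrightarrow> P (A 0) x - P (\<Inter>n. A n) x"
    by (simp add: sums_def)
  from tendsto_diff[OF tendsto_const this, of "P (A 0) x"] show ?thesis
    by simp
qed

lemma sets_word_borel_open: "openin (word_topology N) A \<Longrightarrow> A \<in> sets (word_borel N)"
  unfolding word_borel_def using openin_subset[of "word_topology N"]
  by (subst sets_measure_of) (auto simp: topspace_word_topology)

lemma cylinder_in_sets: "cylinder N I \<in> sets (word_borel N)"
proof (induction I rule: rev_induct)
  case Nil
  have "cylinder N [] = space (word_borel N)"
    by (auto simp: cylinder_def space_word_borel)
  then show ?case
    by simp
next
  case (snoc i I)
  have "openin (word_topology N) {\<omega> \<in> topspace (word_topology N). \<omega> (length I) \<in> {i} \<inter> {..<N}}"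
    unfolding word_topology_def
    by (rule openin_continuous_map_preimage[OF continuous_map_product_projection]) auto
  then have "{\<omega> \<in> inf_words N. \<omega> (length I) \<in> {i} \<inter> {..<N}} \<in> sets (word_borel N)"
    by (auto intro: sets_word_borel_open simp: topspace_word_topology)
  moreover have "cylinder N (I @ [i]) = cylinder N I \<inter> {\<omega> \<in> inf_words N. \<omega> (length I) \<in> {i} \<inter> {..<N}}"
    by (auto simp: cylinder_def nth_append inf_words_def less_Suc_eq)
  ultimately show ?case
    using snoc by simp
qed

lemma singleton_eq_Inter_cylinder:
  assumes "\<omega> \<in> inf_words N"
  shows "{\<omega>} = (\<Inter>n. cylinder N (prefix n \<omega>))"
proof -
  have "\<zeta> = \<omega>" if "\<zeta> \<in> (\<Inter>n. cylinder N (prefix n \<omega>))" for \<zeta>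
  proof
    fix k
    have "\<zeta> \<in> cylinder N (prefix (Suc k) \<omega>)"
      using that by blast
    then have "\<forall>j<Suc k. \<zeta> j = prefix (Suc k) \<omega> ! j"
      by (simp add: cylinder_def del: subseq_to_Suc)
    then show "\<zeta> k = \<omega> k"
      by (simp del: subseq_to_Suc)
  qed
  then show ?thesis
    using assms by (auto simp: cylinder_def)
qed

lemma singleton_in_sets:
  assumes "\<omega> \<in> inf_words N"
  shows "{\<omega>} \<in> sets (word_borel N)"
  unfolding singleton_eq_Inter_cylinder[OF assms]
  by (rule sets.countable_INT) (auto intro: cylinder_in_sets)

lemma decseq_cylinder: "decseq (\<lambda>n. cylinder N (prefix n \<omega>))"
  by (rule antimonoI) (auto simp: cylinder_def)

section \<open>The action of the generators on atoms\<close>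

lemma word_op_Nil: "word_op S [] = id"
  and word_op_Cons: "word_op S (i # I) = S i \<circ> word_op S I"
  by (simp_all add: word_op_def)

lemma word_op_append: "word_op S (I @ J) = word_op S I \<circ> word_op S J"
  by (induction I) (simp_all add: word_op_Nil word_op_Cons o_assoc)

locale cuntz_measure =
  fixes N :: nat and S :: "nat \<Rightarrow> 'a::chilbert_space \<Rightarrow> 'a" and P :: "(nat \<Rightarrow> nat) set \<Rightarrow> 'a \<Rightarrow> 'a"
  assumes rep: "cuntz_rep N S" and assoc: "associated_pvm N S P"
begin

abbreviation word_adj :: "nat list \<Rightarrow> 'a \<Rightarrow> 'a" where
  "word_adj I \<equiv> cadjoint (word_op S I)"

lemma generator_bounded: "i < N \<Longrightarrow> bounded_clinear (S i)"
  using rep by (simp add: cuntz_rep_def)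

lemma word_op_bounded: "set I \<subseteq> {..<N} \<Longrightarrow> bounded_clinear (word_op S I)"
  by (induction I)
     (simp_all add: word_op_Nil word_op_Cons bounded_clinear_id bounded_clinear_compose generator_bounded)

lemma word_is_adjoint: "set I \<subseteq> {..<N} \<Longrightarrow> is_adjoint (word_op S I) (word_adj I)"
  by (rule is_adjoint_cadjoint[OF word_op_bounded])

lemma word_adj_bounded: "set I \<subseteq> {..<N} \<Longrightarrow> bounded_clinear (word_adj I)"
  by (rule adjoint_bounded_clinear[OF word_is_adjoint word_op_bounded])

lemma word_adj_Nil: "word_adj [] = id"
  by (rule is_adjoint_imp_cadjoint) (simp add: word_op_Nil is_adjoint_def)

lemma word_adj_append:
  assumes "set I \<subseteq> {..<N}" "set J \<subseteq> {..<N}"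
  shows "word_adj (I @ J) = word_adj J \<circ> word_adj I"
  unfolding word_op_append
  by (rule is_adjoint_imp_cadjoint[OF is_adjoint_compose[OF word_is_adjoint word_is_adjoint]]) fact+

lemma word_adj_Cons:
  assumes "i < N" "set I \<subseteq> {..<N}"
  shows "word_adj (i # I) = word_adj I \<circ> cadjoint (S i)"
  unfolding word_op_Cons
  by (rule is_adjoint_imp_cadjoint[OF is_adjoint_compose[OF is_adjoint_cadjoint word_is_adjoint]])
     (fact generator_bounded[OF assms(1)] assms(2))+

lemma generator_isometry: "i < N \<Longrightarrow> cadjoint (S i) (S i x) = x"
  using rep unfolding cuntz_rep_def by (metis comp_apply id_apply)

lemma word_isometry: "set I \<subseteq> {..<N} \<Longrightarrow> word_adj I (word_op S I x) = x"
proof (induction I)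
  case (Cons i I)
  have "word_op S (i # I) x = S i (word_op S I x)"
    by (simp add: word_op_Cons)
  with Cons show ?case
    by (simp add: word_adj_Cons generator_isometry)
qed (subst word_adj_Nil, simp add: word_op_Nil)

lemma pvm: "projection_valued_measure (word_borel N) P"
  using assoc by (simp add: associated_pvm_def)

lemma P_cylinder: "set I \<subseteq> {..<N} \<Longrightarrow> P (cylinder N I) x = word_op S I (word_adj I x)"
  using assoc by (simp add: associated_pvm_def)

lemma atom:
  assumes "\<omega> \<in> inf_words N"
  shows "bounded_clinear (P {\<omega>})" and "P {\<omega>} (P {\<omega>} x) = P {\<omega>} x"
    and "is_adjoint (P {\<omega>}) (P {\<omega>})"
  by (fact pvmD[OF pvm singleton_in_sets[OF assms]])+

lemma atom_range_iff: "\<omega> \<in> inf_words N \<Longrightarrow> x \<in> range (P {\<omega>}) \<longleftrightarrow> P {\<omega>} x = x"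
  using atom(2) by (auto intro: range_eqI[OF sym])

lemma atoms_orthogonal:
  assumes "\<omega> \<in> inf_words N" "\<zeta> \<in> inf_words N" "\<omega> \<noteq> \<zeta>"
  shows "P {\<omega>} (P {\<zeta>} x) = 0"
proof -
  have "P {\<omega>} (P {\<zeta>} x) = P ({\<omega>} \<inter> {\<zeta>}) x"
    by (rule pvmD(4)[OF pvm, symmetric]) (intro assms singleton_in_sets)+
  also have "{\<omega>} \<inter> {\<zeta>} = {}"
    using assms by simp
  finally show ?thesis
    by (simp add: pvmD(5)[OF pvm sets.top])
qed

lemma atom_selfadjoint: "\<omega> \<in> inf_words N \<Longrightarrow> cinner (P {\<omega>} x) y = cinner x (P {\<omega>} y)"
  using atom(3) by (simp add: is_adjoint_def)

lemma closed_csubspace_atom: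
  assumes "\<omega> \<in> inf_words N"
  shows "closed_csubspace (range (P {\<omega>}))"
proof -
  have "range (P {\<omega>}) = {x. P {\<omega>} x = x}"
    using atom_range_iff[OF assms] by blast
  moreover have "closed {x. P {\<omega>} x = x}"
    by (intro closed_Collect_eq continuous_on_id linear_continuous_on
        bounded_clinear_bounded_linear atom assms)
  moreover have "complex_vector.subspace {x. P {\<omega>} x = x}"
    using atom(1)[OF assms] unfolding complex_vector.subspace_def
    by (simp add: bounded_clinear_zero bounded_clinear_add bounded_clinear_scaleC)
  ultimately show ?thesis
    by (simp add: closed_csubspace_def)
qed

text \<open>The associated measure is prescribed on cylinders only. This limit is how properties of the
  operators \<open>S\<^sub>I S\<^sub>I\<^sup>*\<close> reach the atoms.\<close>

lemma atom_limit:
  assumes "\<omega> \<in> inf_words N"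
  shows "(\<lambda>n. word_op S (prefix n \<omega>) (word_adj (prefix n \<omega>) x)) \<longlonglongrightarrow> P {\<omega>} x"
proof -
  have "(\<lambda>n. P (cylinder N (prefix n \<omega>)) x) \<longlonglongrightarrow> P (\<Inter>n. cylinder N (prefix n \<omega>)) x"
    by (rule pvm_continuous_from_above[OF pvm _ decseq_cylinder]) (auto intro: cylinder_in_sets)
  then show ?thesis
    unfolding singleton_eq_Inter_cylinder[OF assms, symmetric]
    by (simp only: P_cylinder[OF set_prefix_inf_words[OF assms]])
qed

text \<open>On cylinders this is \<open>S\<^sub>i\<^sub>I S\<^sub>i\<^sub>I\<^sup>* S\<^sub>i = S\<^sub>i S\<^sub>I S\<^sub>I\<^sup>*\<close>; pass to the limit.\<close>

lemma generator_atom: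
  assumes i: "i < N" and \<omega>: "\<omega> \<in> inf_words N"
  shows "P {i ## \<omega>} (S i x) = S i (P {\<omega>} x)"
proof (rule LIMSEQ_unique)
  have i\<omega>: "i ## \<omega> \<in> inf_words N"
    using assms by simp
  have "word_op S (prefix (Suc n) (i ## \<omega>)) (word_adj (prefix (Suc n) (i ## \<omega>)) (S i x))
      = S i (word_op S (prefix n \<omega>) (word_adj (prefix n \<omega>) x))" for n
    unfolding prefix_Suc_build word_op_Cons[of S i]
      word_adj_Cons[OF i set_prefix_inf_words[OF \<omega>], unfolded word_op_Cons]
    by (simp add: generator_isometry[OF i])
  with LIMSEQ_Suc[OF atom_limit[OF i\<omega>, of "S i x"]]
  show "(\<lambda>n. S i (word_op S (prefix n \<omega>) (word_adj (prefix n \<omega>) x))) \<longlonglongrightarrow> P {i ## \<omega>} (S i x)"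
    by (simp only:)
  show "(\<lambda>n. S i (word_op S (prefix n \<omega>) (word_adj (prefix n \<omega>) x))) \<longlonglongrightarrow> S i (P {\<omega>} x)"
    by (rule bounded_linear.tendsto[OF bounded_clinear_bounded_linear[OF generator_bounded[OF i]] atom_limit[OF \<omega>]])
qed

lemma word_atom:
  assumes "set I \<subseteq> {..<N}" "\<omega> \<in> inf_words N"
  shows "P {I \<frown> \<omega>} (word_op S I x) = word_op S I (P {\<omega>} x)"
  using assms(1)
proof (induction I)
  case (Cons i I)
  then show ?case
    using generator_atom[of i "I \<frown> \<omega>" "word_op S I x"] assms(2) by (simp add: word_op_Cons)
qed (simp add: word_op_Nil)

lemma word_adj_atom:
  assumes I: "set I \<subseteq> {..<N}" and \<omega>: "\<omega> \<in> inf_words N"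
  shows "word_adj I (P {I \<frown> \<omega>} x) = P {\<omega>} (word_adj I x)"
proof (rule cinner_ext)
  fix z
  have adj: "cinner u (word_adj I v) = cinner (word_op S I u) v" for u v
    using word_is_adjoint[OF I] unfolding is_adjoint_def by simp
  have I\<omega>: "I \<frown> \<omega> \<in> inf_words N"
    using assms by simp
  have "cinner z (word_adj I (P {I \<frown> \<omega>} x)) = cinner (P {I \<frown> \<omega>} (word_op S I z)) x"
    unfolding adj atom_selfadjoint[OF I\<omega>] ..
  also have "\<dots> = cinner (P {\<omega>} z) (word_adj I x)"
    unfolding word_atom[OF assms] adj ..
  finally show "cinner z (word_adj I (P {I \<frown> \<omega>} x)) = cinner z (P {\<omega>} (word_adj I x))"
    unfolding atom_selfadjoint[OF \<omega>] .
qed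

text \<open>The projection \<open>S\<^sub>I S\<^sub>I\<^sup>*\<close> belongs to the cylinder of \<open>I\<close>, which contains \<open>I \<frown> \<omega>\<close>.\<close>

lemma word_coisometry:
  assumes I: "set I \<subseteq> {..<N}" and \<omega>: "\<omega> \<in> inf_words N" and x: "x \<in> range (P {I \<frown> \<omega>})"
  shows "word_op S I (word_adj I x) = x"
proof -
  have I\<omega>: "I \<frown> \<omega> \<in> inf_words N"
    using assms by simp
  obtain y where y: "x = P {I \<frown> \<omega>} y"
    using x by blast
  have "word_op S I (word_adj I x) = P (cylinder N I \<inter> {I \<frown> \<omega>}) y"
    unfolding y P_cylinder[OF I, symmetric]
    by (rule pvmD(4)[OF pvm cylinder_in_sets singleton_in_sets[OF I\<omega>], symmetric])
  also have "cylinder N I \<inter> {I \<frown> \<omega>} = {I \<frown> \<omega>}"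
    using I\<omega> by (auto simp: cylinder_def)
  finally show ?thesis
    by (simp add: y)
qed

lemma word_unitary:
  assumes I: "set I \<subseteq> {..<N}" and \<omega>: "\<omega> \<in> inf_words N"
  shows "unitary_between (range (P {\<omega>})) (range (P {I \<frown> \<omega>})) (word_op S I)"
  unfolding unitary_between_def
proof (intro conjI ballI allI)
  show "cinner (word_op S I x) (word_op S I y) = cinner x y" for x y
    using word_is_adjoint[OF I] word_isometry[OF I] by (simp add: is_adjoint_def)
  show "word_op S I ` range (P {\<omega>}) = range (P {I \<frown> \<omega>})"
  proof (intro equalityI subsetI)
    fix y assume "y \<in> word_op S I ` range (P {\<omega>})"
    then obtain x where "y = word_op S I (P {\<omega>} x)"
      by blast
    then show "y \<in> range (P {I \<frown> \<omega>})"
      unfolding word_atom[OF assms, symmetric] by blast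
  next
    fix y assume y: "y \<in> range (P {I \<frown> \<omega>})"
    then obtain x where x: "y = P {I \<frown> \<omega>} x"
      by blast
    have "y = word_op S I (P {\<omega>} (word_adj I x))"
      using word_coisometry[OF assms y] unfolding x word_adj_atom[OF assms] by simp
    then show "y \<in> word_op S I ` range (P {\<omega>})"
      by blast
  qed
qed (simp_all add: bounded_clinear_add bounded_clinear_scaleC word_op_bounded[OF I])

lemma word_adj_unitary:
  assumes I: "set I \<subseteq> {..<N}" and \<omega>: "\<omega> \<in> inf_words N"
  shows "unitary_between (range (P {I \<frown> \<omega>})) (range (P {\<omega>})) (word_adj I)"
  unfolding unitary_between_def
proof (intro conjI ballI allI)
  show "cinner (word_adj I x) (word_adj I y) = cinner x y" if "x \<in> range (P {I \<frown> \<omega>})" for x y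
  proof -
    have "cinner (word_adj I x) (word_adj I y) = cinner (word_op S I (word_adj I x)) y"
      using word_is_adjoint[OF I] by (simp add: is_adjoint_def)
    then show ?thesis
      by (simp add: word_coisometry[OF assms that])
  qed
  show "word_adj I ` range (P {I \<frown> \<omega>}) = range (P {\<omega>})"
  proof (intro equalityI subsetI)
    fix y assume "y \<in> word_adj I ` range (P {I \<frown> \<omega>})"
    then obtain x where "y = word_adj I (P {I \<frown> \<omega>} x)"
      by blast
    then show "y \<in> range (P {\<omega>})"
      unfolding word_adj_atom[OF assms] by blast
  next
    fix y assume "y \<in> range (P {\<omega>})"
    then obtain x where x: "y = P {\<omega>} x"
      by blast
    have "y = word_adj I (P {I \<frown> \<omega>} (word_op S I x))"
      unfolding word_atom[OF assms] word_isometry[OF I] x ..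
    then show "y \<in> word_adj I ` range (P {I \<frown> \<omega>})"
      by blast
  qed
qed (simp_all add: bounded_clinear_add bounded_clinear_scaleC word_adj_bounded[OF I])

text \<open>The set of words in the definition of pure atomicity may be enlarged to all words: an atom
  outside it is orthogonal to every term of an expansion of the identity, hence zero.\<close>

lemma atomic_resolution:
  assumes "purely_atomic N P"
  shows "orthogonal_resolution UNIV (inf_words N) (\<lambda>\<omega>. P {\<omega>})"
  unfolding orthogonal_resolution_def
proof (intro conjI ballI impI allI)
  obtain \<Omega> where \<Omega>: "\<Omega> \<subseteq> inf_words N" "\<And>x. ((\<lambda>\<omega>. P {\<omega>} x) has_sum x) \<Omega>"
    using assms unfolding purely_atomic_def by blast
  have off: "P {\<omega>} x = 0" if "\<omega> \<in> inf_words N - \<Omega>" for \<omega> x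
  proof -
    have \<omega>: "\<omega> \<in> inf_words N"
      using that by blast
    have "((\<lambda>\<zeta>. P {\<omega>} (P {\<zeta>} x)) has_sum P {\<omega>} x) \<Omega>"
      by (rule has_sum_bounded_linear[OF bounded_clinear_bounded_linear[OF atom(1)[OF \<omega>]] \<Omega>(2)])
    moreover have "P {\<omega>} (P {\<zeta>} x) = 0" if "\<zeta> \<in> \<Omega>" for \<zeta>
      by (rule atoms_orthogonal[OF \<omega>]) (use \<open>\<omega> \<in> inf_words N - \<Omega>\<close> that \<Omega>(1) in auto)
    ultimately show ?thesis
      by (rule has_sum_unique[OF _ has_sum_0])
  qed
  show "((\<lambda>\<omega>. P {\<omega>} x) has_sum x) (inf_words N)" for x
    by (rule iffD1[OF has_sum_cong_neutral \<Omega>(2)]) (use off \<Omega>(1) in auto)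
  show "cinner (P {\<omega>} x) (P {\<zeta>} y) = 0"
    if "\<omega> \<in> inf_words N" "\<zeta> \<in> inf_words N" "\<omega> \<noteq> \<zeta>" for \<omega> \<zeta> x y
    using that by (simp add: atom_selfadjoint atoms_orthogonal)
qed (auto intro: atom closed_csubspace_UNIV)

end

section \<open>Unitarily equivalent representations\<close>

locale cuntz_measure_pair =
  S: cuntz_measure N S P + S': cuntz_measure N S' P'
  for N :: nat
    and S :: "nat \<Rightarrow> 'a::chilbert_space \<Rightarrow> 'a" and P :: "(nat \<Rightarrow> nat) set \<Rightarrow> 'a \<Rightarrow> 'a"
    and S' :: "nat \<Rightarrow> 'b::chilbert_space \<Rightarrow> 'b" and P' :: "(nat \<Rightarrow> nat) set \<Rightarrow> 'b \<Rightarrow> 'b"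
begin

definition intertwines :: "(nat \<Rightarrow> nat) \<Rightarrow> nat list \<Rightarrow> ('a \<Rightarrow> 'b) \<Rightarrow> bool" where
  "intertwines \<omega> I V \<longleftrightarrow> (\<forall>x\<in>range (P {\<omega>}). V (word_op S I x) = word_op S' I (V x))"

abbreviation atom_unitary :: "(nat \<Rightarrow> nat) \<Rightarrow> ('a \<Rightarrow> 'b) \<Rightarrow> bool" where
  "atom_unitary \<omega> \<equiv> unitary_between (range (P {\<omega>})) (range (P' {\<omega>}))"

lemma equivalence_word:
  assumes "\<And>i x. i < N \<Longrightarrow> U (S i x) = S' i (U x)" "set I \<subseteq> {..<N}"
  shows "U (word_op S I x) = word_op S' I (U x)"
  using assms(2) by (induction I) (simp_all add: word_op_Nil word_op_Cons assms(1))

lemma equivalence_word_adj: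
  assumes U: "unitary_between UNIV UNIV U" "\<And>i x. i < N \<Longrightarrow> U (S i x) = S' i (U x)"
    and I: "set I \<subseteq> {..<N}"
  shows "U (S.word_adj I x) = S'.word_adj I (U x)"
proof (rule cinner_ext)
  fix z
  obtain w where w: "z = U w"
    using unitary_betweenD(4)[OF U(1)] by (metis UNIV_I imageE)
  have inner: "cinner (U a) (U b) = cinner a b" for a b
    using unitary_betweenD(3)[OF U(1)] by simp
  have "cinner z (U (S.word_adj I x)) = cinner (word_op S I w) x"
    unfolding w inner using S.word_is_adjoint[OF I] by (simp add: is_adjoint_def)
  also have "\<dots> = cinner (word_op S' I z) (U x)"
    unfolding w by (simp only: equivalence_word[OF U(2) I, symmetric] inner)
  also have "\<dots> = cinner z (S'.word_adj I (U x))"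
    using S'.word_is_adjoint[OF I] by (simp add: is_adjoint_def)
  finally show "cinner z (U (S.word_adj I x)) = cinner z (S'.word_adj I (U x))" .
qed

text \<open>An equivalence intertwines also the adjoints, hence the projections of cylinders, and by
  continuity those of single words.\<close>

lemma equivalence_atom:
  assumes U: "unitary_between UNIV UNIV U" "\<And>i x. i < N \<Longrightarrow> U (S i x) = S' i (U x)"
    and \<omega>: "\<omega> \<in> inf_words N"
  shows "U (P {\<omega>} x) = P' {\<omega>} (U x)"
proof (rule LIMSEQ_unique)
  note I = set_prefix_inf_words[OF \<omega>]
  have "(\<lambda>n. U (word_op S (prefix n \<omega>) (S.word_adj (prefix n \<omega>) x))) \<longlonglongrightarrow> U (P {\<omega>} x)"
    by (rule bounded_linear.tendsto[OF bounded_clinear_bounded_linear S.atom_limit[OF \<omega>]])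
       (rule unitary_between_UNIV_bounded_clinear[OF U(1)])
  then show "(\<lambda>n. word_op S' (prefix n \<omega>) (S'.word_adj (prefix n \<omega>) (U x))) \<longlonglongrightarrow> U (P {\<omega>} x)"
    by (simp only: equivalence_word[OF U(2) I] equivalence_word_adj[OF U I])
  show "(\<lambda>n. word_op S' (prefix n \<omega>) (S'.word_adj (prefix n \<omega>) (U x))) \<longlonglongrightarrow> P' {\<omega>} (U x)"
    by (rule S'.atom_limit[OF \<omega>])
qed

lemma equivalence_atom_unitary:
  assumes U: "unitary_between UNIV UNIV U" "\<And>i x. i < N \<Longrightarrow> U (S i x) = S' i (U x)"
    and \<omega>: "\<omega> \<in> inf_words N"
  shows "atom_unitary \<omega> U"
proof (rule unitary_between_restrict[OF U(1) subset_UNIV])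
  have "U ` range (P {\<omega>}) = P' {\<omega>} ` range U"
    by (simp add: image_image equivalence_atom[OF assms])
  also have "range U = UNIV"
    using unitary_betweenD(4)[OF U(1)] .
  finally show "U ` range (P {\<omega>}) = range (P' {\<omega>})" .
qed

lemma equivalence_atomic_support:
  assumes U: "unitary_between UNIV UNIV U" "\<And>i x. i < N \<Longrightarrow> U (S i x) = S' i (U x)"
  shows "atomic_support N P = atomic_support N P'"
proof -
  have "P {\<omega>} = (\<lambda>_. 0) \<longleftrightarrow> P' {\<omega>} = (\<lambda>_. 0)" if \<omega>: "\<omega> \<in> inf_words N" for \<omega>
  proof -
    have zero: "U x = 0 \<longleftrightarrow> x = 0" for x
      using unitary_between_norm[OF U(1), of x] by (metis UNIV_I norm_eq_zero)
    have "P {\<omega>} = (\<lambda>_. 0) \<longleftrightarrow> (\<forall>x. U (P {\<omega>} x) = 0)"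
      by (simp add: zero fun_eq_iff)
    also have "\<dots> \<longleftrightarrow> (\<forall>y\<in>range U. P' {\<omega>} y = 0)"
      by (simp add: equivalence_atom[OF U \<omega>])
    also have "\<dots> \<longleftrightarrow> P' {\<omega>} = (\<lambda>_. 0)"
      using unitary_betweenD(4)[OF U(1)] by (simp add: fun_eq_iff)
    finally show ?thesis .
  qed
  then show ?thesis
    by (auto simp: atomic_support_def)
qed

section \<open>Transport along an orbit\<close>

text \<open>The map that a unitary \<open>V\<close> between the atoms of \<open>K \<frown> \<tau>\<close> induces between the atoms of
  \<open>J \<frown> \<tau>\<close> when \<open>K\<close> is removed and \<open>J\<close> is prepended in both representations.\<close>

definition transport :: "nat list \<Rightarrow> nat list \<Rightarrow> ('a \<Rightarrow> 'b) \<Rightarrow> 'a \<Rightarrow> 'b" where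
  "transport J K V = word_op S' J \<circ> S'.word_adj K \<circ> V \<circ> word_op S K \<circ> S.word_adj J"

lemma transport_unitary:
  assumes "set J \<subseteq> {..<N}" "set K \<subseteq> {..<N}" "\<tau> \<in> inf_words N" "atom_unitary (K \<frown> \<tau>) V"
  shows "atom_unitary (J \<frown> \<tau>) (transport J K V)"
  unfolding transport_def
  by (intro unitary_between_compose[OF S.word_adj_unitary] unitary_between_compose[OF S.word_unitary]
      unitary_between_compose[OF assms(4)] unitary_between_compose[OF S'.word_adj_unitary]
      S'.word_unitary assms)

lemma transport_generator:
  assumes "i < N" "set J \<subseteq> {..<N}"
  shows "transport (i # J) K V (S i x) = S' i (transport J K V x)"
proof -
  have "S.word_adj (i # J) (S i x) = S.word_adj J x"
    unfolding S.word_adj_Cons[OF assms] by (simp add: S.generator_isometry[OF assms(1)])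
  then show ?thesis
    by (simp add: transport_def) (simp add: word_op_Cons)
qed

text \<open>The inserted factors \<open>S\<^sub>L\<close> and \<open>S\<^sub>L\<^sup>*\<close>, and likewise \<open>S'\<^sub>L\<close> and \<open>S'\<^sub>L\<^sup>*\<close>, are mutually
  inverse on the atoms where they act.\<close>

lemma transport_append:
  assumes J: "set J \<subseteq> {..<N}" and K: "set K \<subseteq> {..<N}" and L: "set L \<subseteq> {..<N}"
    and \<tau>: "\<tau> \<in> inf_words N" and V: "atom_unitary (K \<frown> L \<frown> \<tau>) V"
    and x: "x \<in> range (P {J \<frown> L \<frown> \<tau>})"
  shows "transport (J @ L) (K @ L) V x = transport J K V x"
proof -
  have L\<tau>: "L \<frown> \<tau> \<in> inf_words N"
    using L \<tau> by simp
  \<comment> \<open>Both \<open>y\<close> and, in the other space, \<open>z\<close> lie in atoms of \<open>L \<frown> \<tau>\<close>, where \<open>S\<^sub>L S\<^sub>L\<^sup>*\<close>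
    is the identity.\<close>
  define y where "y = S.word_adj J x"
  have "y \<in> range (P {L \<frown> \<tau>})"
    unfolding y_def by (rule unitary_betweenD(5)[OF S.word_adj_unitary[OF J L\<tau>] x])
  then have y: "word_op S L (S.word_adj L y) = y" and Ky: "word_op S K y \<in> range (P {K \<frown> L \<frown> \<tau>})"
    using S.word_coisometry[OF L \<tau>] unitary_betweenD(5)[OF S.word_unitary[OF K L\<tau>]] by blast+
  define z where "z = S'.word_adj K (V (word_op S K y))"
  have "z \<in> range (P' {L \<frown> \<tau>})"
    unfolding z_def
    by (rule unitary_betweenD(5)[OF S'.word_adj_unitary[OF K L\<tau>] unitary_betweenD(5)[OF V Ky]])
  then have z: "word_op S' L (S'.word_adj L z) = z"
    by (rule S'.word_coisometry[OF L \<tau>])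
  have "transport (J @ L) (K @ L) V x
      = word_op S' J (word_op S' L (S'.word_adj L (S'.word_adj K (V (word_op S K
          (word_op S L (S.word_adj L (S.word_adj J x))))))))"
    unfolding transport_def S.word_adj_append[OF J L] S'.word_adj_append[OF K L]
    by (simp add: word_op_append)
  also have "\<dots> = word_op S' J (word_op S' L (S'.word_adj L z))"
    unfolding y_def[symmetric] y z_def[symmetric] ..
  also have "\<dots> = transport J K V x"
    unfolding z unfolding z_def y_def transport_def by simp
  finally show ?thesis .
qed

lemma transport_prefix_add:
  assumes r: "r \<in> inf_words N" and \<omega>: "\<omega> \<in> inf_words N" and V: "atom_unitary r V"
    and eq: "suffix m \<omega> = suffix n r" and x: "x \<in> range (P {\<omega>})"
  shows "transport (prefix (m + k) \<omega>) (prefix (n + k) r) V x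
    = transport (prefix m \<omega>) (prefix n r) V x"
proof -
  define L \<tau> where "L = prefix k (suffix m \<omega>)" and "\<tau> = suffix k (suffix m \<omega>)"
  have tail: "L \<frown> \<tau> = suffix m \<omega>"
    unfolding L_def \<tau>_def by (rule prefix_suffix[symmetric])
  show ?thesis
    unfolding prefix_add eq[symmetric] L_def[symmetric]
  proof (rule transport_append)
    show "set L \<subseteq> {..<N}"
      unfolding L_def by (intro set_prefix_inf_words inf_words_suffix \<omega>)
    show "\<tau> \<in> inf_words N"
      unfolding \<tau>_def by (intro inf_words_suffix \<omega>)
    show "atom_unitary (prefix n r \<frown> L \<frown> \<tau>) V"
      unfolding tail unfolding eq prefix_suffix[symmetric] by (rule V)
    show "x \<in> range (P {prefix m \<omega> \<frown> L \<frown> \<tau>})"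
      unfolding tail prefix_suffix[symmetric] by (rule x)
  qed (intro set_prefix_inf_words r \<omega>)+
qed

text \<open>Going once around a cycle gives \<open>S'\<^sub>I V S\<^sub>I\<^sup>* = V S\<^sub>I S\<^sub>I\<^sup>* = V\<close>. This is the one place where
  the intertwining condition at a cycle enters.\<close>

lemma transport_cycle:
  assumes "set I \<subseteq> {..<N}" "r \<in> inf_words N" "I \<frown> r = r" "intertwines r I V" "x \<in> range (P {r})"
  shows "transport I [] V x = V x"
proof -
  have x: "x \<in> range (P {I \<frown> r})"
    using assms by simp
  have "V (word_op S I (S.word_adj I x)) = word_op S' I (V (S.word_adj I x))"
    using assms(4) unitary_betweenD(5)[OF S.word_adj_unitary[OF assms(1,2)] x]
    unfolding intertwines_def by blast
  then show ?thesis
    unfolding S.word_coisometry[OF assms(1,2) x] transport_def S'.word_adj_Nil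
    by (simp add: word_op_Nil)
qed

definition intertwining_family :: "(nat \<Rightarrow> nat) \<Rightarrow> ((nat \<Rightarrow> nat) \<Rightarrow> 'a \<Rightarrow> 'b) \<Rightarrow> bool" where
  "intertwining_family r u \<longleftrightarrow> (\<forall>\<omega>\<in>inf_words N. tail_equivalent \<omega> r \<longrightarrow> atom_unitary \<omega> (u \<omega>) \<and>
     (\<forall>i<N. \<forall>x\<in>range (P {\<omega>}). u (i ## \<omega>) (S i x) = S' i (u \<omega> x)))"

text \<open>A choice of \<open>m\<close> and \<open>n\<close> with \<open>suffix m \<omega> = suffix n r\<close> for every word \<open>\<omega>\<close>
  of the orbit determines a family of unitaries. It intertwines the generators as soon as
  prepending a letter to \<open>\<omega>\<close> and choosing afresh is the same as increasing \<open>m\<close> by one.\<close>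

lemma orbit_family_from_choice:
  assumes r: "r \<in> inf_words N" and V: "atom_unitary r V"
    and choice: "\<And>\<omega>. \<omega> \<in> inf_words N \<Longrightarrow> tail_equivalent \<omega> r \<Longrightarrow> suffix (m \<omega>) \<omega> = suffix (n \<omega>) r"
    and coherent: "\<And>\<omega> i x. \<omega> \<in> inf_words N \<Longrightarrow> tail_equivalent \<omega> r \<Longrightarrow> i < N \<Longrightarrow> x \<in> range (P {i ## \<omega>}) \<Longrightarrow>
      transport (prefix (m (i ## \<omega>)) (i ## \<omega>)) (prefix (n (i ## \<omega>)) r) V x
      = transport (prefix (Suc (m \<omega>)) (i ## \<omega>)) (prefix (n \<omega>) r) V x"
  shows "\<exists>u. intertwining_family r u"
  unfolding intertwining_family_def
proof (intro exI ballI impI conjI allI)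
  let ?u = "\<lambda>\<omega>. transport (prefix (m \<omega>) \<omega>) (prefix (n \<omega>) r) V"
  fix \<omega> assume \<omega>: "\<omega> \<in> inf_words N" "tail_equivalent \<omega> r"
  have "atom_unitary (prefix (m \<omega>) \<omega> \<frown> suffix (m \<omega>) \<omega>) (?u \<omega>)"
  proof (rule transport_unitary)
    show "atom_unitary (prefix (n \<omega>) r \<frown> suffix (m \<omega>) \<omega>) V"
      unfolding choice[OF \<omega>] prefix_suffix[symmetric] by (rule V)
  qed (intro set_prefix_inf_words inf_words_suffix r \<omega>)+
  then show "atom_unitary \<omega> (?u \<omega>)"
    by (simp only: prefix_suffix[symmetric])
  fix i x assume i: "i < N" and x: "x \<in> range (P {\<omega>})"
  obtain y where y: "x = P {\<omega>} y"
    using x by blast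
  have "S i x \<in> range (P {i ## \<omega>})"
    unfolding y S.generator_atom[OF i \<omega>(1), symmetric] by (rule rangeI)
  then have "?u (i ## \<omega>) (S i x) = transport (prefix (Suc (m \<omega>)) (i ## \<omega>)) (prefix (n \<omega>) r) V (S i x)"
    by (rule coherent[OF \<omega> i])
  also have "\<dots> = S' i (?u \<omega> x)"
    unfolding prefix_Suc_build by (rule transport_generator[OF i set_prefix_inf_words[OF \<omega>(1)]])
  finally show "?u (i ## \<omega>) (S i x) = S' i (?u \<omega> x)" .
qed

text \<open>Any choice of \<open>m\<close> and \<open>n\<close> is coherent here. Two choices with different values of \<open>m - n\<close> would
  produce two equal tails of \<open>\<omega>\<close> at different positions, that is, a cycle in the orbit; and choices
  with the same value of \<open>m - n\<close> give the same transport by \<open>transport_prefix_add\<close>.\<close>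

lemma orbit_family_aperiodic:
  assumes r: "r \<in> inf_words N" and V: "atom_unitary r V"
    and aperiodic: "\<And>\<omega>. \<omega> \<in> inf_words N \<Longrightarrow> tail_equivalent \<omega> r \<Longrightarrow> \<not> is_cycle \<omega>"
  shows "\<exists>u. intertwining_family r u"
proof -
  have degree: "m + n' \<ge> m' + n"
    if \<omega>: "\<omega> \<in> inf_words N" and eq: "suffix m \<omega> = suffix n r" "suffix m' \<omega> = suffix n' r" for \<omega> m n m' n'
  proof (rule ccontr)
    define a b where "a = m + n'" and "b = m' + n"
    assume "\<not> m' + n \<le> m + n'"
    then have "a < b"
      by (simp add: a_def b_def)
    have "suffix a \<omega> = suffix n' (suffix n r)"
      by (simp add: a_def flip: eq(1))
    also have "\<dots> = suffix n (suffix n' r)"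
      by (simp add: add.commute)
    also have "\<dots> = suffix b \<omega>"
      by (simp add: b_def flip: eq(2))
    also have "suffix b \<omega> = suffix (b - a) (suffix a \<omega>)"
      using \<open>a < b\<close> by simp
    finally have "suffix (b - a) (suffix a \<omega>) = suffix a \<omega>" ..
    then have "is_cycle (suffix a \<omega>)"
      using \<open>a < b\<close> unfolding is_cycle_iff_suffix by (meson zero_less_diff)
    moreover have "tail_equivalent \<omega> r"
      using eq(1) unfolding tail_equivalent_def by blast
    then have "tail_equivalent (suffix a \<omega>) r"
      by (rule tail_equivalent_trans[OF tail_equivalent_suffix])
    ultimately show False
      using aperiodic inf_words_suffix[OF \<omega>] by blast
  qed
  have independent: "transport (prefix m \<omega>) (prefix n r) V x = transport (prefix m' \<omega>) (prefix n' r) V x"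
    if \<omega>: "\<omega> \<in> inf_words N" and eq: "suffix m \<omega> = suffix n r" "suffix m' \<omega> = suffix n' r"
      and x: "x \<in> range (P {\<omega>})" for \<omega> m n m' n' x
  proof -
    have deg: "m + n' = m' + n"
      using degree[OF \<omega> eq] degree[OF \<omega> eq(2,1)] by simp
    show ?thesis
    proof (cases "m \<le> m'")
      case True
      then have "m' = m + (m' - m)" "n' = n + (m' - m)"
        using deg by simp_all
      then show ?thesis
        using transport_prefix_add[OF r \<omega> V eq(1) x, of "m' - m"] by simp
    next
      case False
      then have "m = m' + (m - m')" "n = n' + (m - m')"
        using deg by simp_all
      then show ?thesis
        using transport_prefix_add[OF r \<omega> V eq(2) x, of "m - m'"] by simp
    qed
  qed
  have "\<forall>\<omega>. \<exists>m n. tail_equivalent \<omega> r \<longrightarrow> suffix m \<omega> = suffix n r"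
    by (auto simp: tail_equivalent_def)
  then obtain m n where mn: "\<And>\<omega>. tail_equivalent \<omega> r \<Longrightarrow> suffix (m \<omega>) \<omega> = suffix (n \<omega>) r"
    by metis
  show ?thesis
  proof (rule orbit_family_from_choice[OF r V])
    show "suffix (m \<omega>) \<omega> = suffix (n \<omega>) r" if "tail_equivalent \<omega> r" for \<omega>
      by (rule mn[OF that])
    fix \<omega> i x
    assume *: "\<omega> \<in> inf_words N" "tail_equivalent \<omega> r" "i < N" "x \<in> range (P {i ## \<omega>})"
    show "transport (prefix (m (i ## \<omega>)) (i ## \<omega>)) (prefix (n (i ## \<omega>)) r) V x
        = transport (prefix (Suc (m \<omega>)) (i ## \<omega>)) (prefix (n \<omega>) r) V x"
    proof (rule independent[OF _ mn _ *(4)])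
      show "i ## \<omega> \<in> inf_words N"
        using * by simp
      show "tail_equivalent (i ## \<omega>) r"
        by (rule tail_equivalent_trans[OF tail_equivalent_build *(2)])
      show "suffix (Suc (m \<omega>)) (i ## \<omega>) = suffix (n \<omega>) r"
        using mn[OF *(2)] by simp
    qed
  qed
qed

text \<open>Take \<open>n = 0\<close> and for \<open>m\<close> the number of letters before the first arrival at \<open>r\<close>. Prepending a
  letter increases \<open>m\<close> by one, unless the new word is \<open>r\<close>: then a full period has been completed,
  whose transport is trivial by \<open>transport_cycle\<close>.\<close>

lemma orbit_family_cycle:
  assumes r: "r \<in> inf_words N" and cycle: "is_cycle r" and V: "atom_unitary r V"
    and intertwines: "intertwines r (prefix (period r) r) V"
  shows "\<exists>u. intertwining_family r u"
proof -
  define m where "m \<omega> = (LEAST m. suffix m \<omega> = r)" for \<omega>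
  have m: "suffix (m \<omega>) \<omega> = r" if "tail_equivalent \<omega> r" for \<omega>
    unfolding m_def using tail_equivalent_cycle[OF cycle that] by (rule LeastI_ex)
  show ?thesis
  proof (rule orbit_family_from_choice[OF r V, of m "\<lambda>_. 0"])
    show "suffix (m \<omega>) \<omega> = suffix 0 r" if "tail_equivalent \<omega> r" for \<omega>
      using m[OF that] by simp
    fix \<omega> i x
    assume *: "\<omega> \<in> inf_words N" "tail_equivalent \<omega> r" "i < N" "x \<in> range (P {i ## \<omega>})"
    show "transport (prefix (m (i ## \<omega>)) (i ## \<omega>)) (prefix 0 r) V x
        = transport (prefix (Suc (m \<omega>)) (i ## \<omega>)) (prefix 0 r) V x"
    proof (cases "i ## \<omega> = r")
      case False
      have "suffix (Suc (m \<omega>)) (i ## \<omega>) = r"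
        using m[OF *(2)] by simp
      then have "m (i ## \<omega>) = Suc (LEAST m. suffix (Suc m) (i ## \<omega>) = r)"
        unfolding m_def by (rule Least_Suc) (use False in simp)
      then show ?thesis
        by (simp add: m_def)
    next
      case True
      have "m r = 0"
        unfolding m_def by (rule Least_equality) simp_all
      moreover have "(LEAST m. suffix (Suc m) r = r) = m \<omega>"
        unfolding m_def by (subst (1) True[symmetric]) simp
      then have "period r = Suc (m \<omega>)"
        by (simp add: period_def)
      moreover have "transport (prefix (period r) r) [] V x = V x"
      proof (rule transport_cycle[OF set_prefix_inf_words[OF r] r _ intertwines])
        show "prefix (period r) r \<frown> r = r"
          using prefix_suffix[of r "period r"] suffix_period[OF cycle] by simp
        show "x \<in> range (P {r})"
          using *(4) True by simp
      qed
      moreover have "transport [] [] V x = V x"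
        by (rule transport_cycle) (use r *(4) True in \<open>simp_all add: intertwines_def word_op_Nil\<close>)
      ultimately show ?thesis
        unfolding True by simp
    qed
  qed
qed

section \<open>Assembling an equivalence from its restrictions to the atoms\<close>

text \<open>The words from which a family on an orbit can be started: a cycle if the orbit has one.\<close>

definition good_anchor :: "(nat \<Rightarrow> nat) \<Rightarrow> bool" where
  "good_anchor r \<longleftrightarrow> r \<in> inf_words N \<and>
     (is_cycle r \<or> (\<forall>\<omega>\<in>inf_words N. tail_equivalent \<omega> r \<longrightarrow> \<not> is_cycle \<omega>))"

text \<open>Choosing one anchor for each orbit yields a family of unitaries on all atoms that is compatible
  with the generators. The glued unitary then intertwines the generators on each atom, and so
  everywhere by linearity and continuity.\<close>

lemma equivalence_from_atoms:
  assumes "purely_atomic N P" "purely_atomic N P'"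
    and local_unitary: "\<And>\<omega>. \<omega> \<in> inf_words N \<Longrightarrow>
      \<exists>V. atom_unitary \<omega> V \<and> (is_cycle \<omega> \<longrightarrow> intertwines \<omega> (prefix (period \<omega>) \<omega>) V)"
  shows "unitarily_equivalent N S S'"
proof -
  have family: "\<exists>u. intertwining_family r u" if r: "good_anchor r" for r
  proof -
    have rN: "r \<in> inf_words N"
      using r by (simp add: good_anchor_def)
    obtain V where V: "atom_unitary r V" "is_cycle r \<longrightarrow> intertwines r (prefix (period r) r) V"
      using local_unitary[OF rN] by blast
    show ?thesis
    proof (cases "is_cycle r")
      case True
      show ?thesis
        by (rule orbit_family_cycle[OF rN True V(1) V(2)[rule_format, OF True]])
    next
      case False
      show ?thesis
        by (rule orbit_family_aperiodic[OF rN V(1)]) (use False r in \<open>simp add: good_anchor_def\<close>)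
    qed
  qed
  then obtain f where family: "\<And>r. good_anchor r \<Longrightarrow> intertwining_family r (f r)"
    by metis
  have f: "atom_unitary \<omega> (f r \<omega>) \<and> (\<forall>i<N. \<forall>x\<in>range (P {\<omega>}). f r (i ## \<omega>) (S i x) = S' i (f r \<omega> x))"
    if "good_anchor r" "\<omega> \<in> inf_words N" "tail_equivalent \<omega> r" for r \<omega>
    using family[OF that(1)] that(2,3) unfolding intertwining_family_def by blast
  define anchor where "anchor \<omega> = (SOME r. good_anchor r \<and> tail_equivalent \<omega> r)" for \<omega>
  have anchor: "good_anchor (anchor \<omega>) \<and> tail_equivalent \<omega> (anchor \<omega>)" if \<omega>: "\<omega> \<in> inf_words N" for \<omega>
  proof -
    have "\<exists>r. good_anchor r \<and> tail_equivalent \<omega> r"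
    proof (cases "\<exists>c\<in>inf_words N. is_cycle c \<and> tail_equivalent \<omega> c")
      case True
      then show ?thesis
        by (auto simp: good_anchor_def)
    next
      case False
      then have "good_anchor \<omega>"
        using \<omega> tail_equivalent_sym by (auto simp: good_anchor_def)
      then show ?thesis
        using tail_equivalent_refl by blast
    qed
    then show ?thesis
      unfolding anchor_def by (rule someI_ex)
  qed
  have anchor_build: "anchor (i ## \<omega>) = anchor \<omega>" for i \<omega>
  proof -
    have "tail_equivalent (i ## \<omega>) r \<longleftrightarrow> tail_equivalent \<omega> r" for r
      using tail_equivalent_build tail_equivalent_sym tail_equivalent_trans by blast
    then show ?thesis
      by (simp add: anchor_def)
  qed
  define u where "u \<omega> = f (anchor \<omega>) \<omega>" for \<omega>
  have u: "atom_unitary \<omega> (u \<omega>)" if "\<omega> \<in> inf_words N" for \<omega>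
    unfolding u_def using f anchor[OF that] that by blast
  have u_gen: "u (i ## \<omega>) (S i x) = S' i (u \<omega> x)"
    if "\<omega> \<in> inf_words N" "i < N" "x \<in> range (P {\<omega>})" for \<omega> i x
    unfolding u_def anchor_build using f anchor[OF that(1)] that by blast
  obtain U where U: "unitary_between UNIV UNIV U"
    and Uu: "\<And>\<omega> x. \<omega> \<in> inf_words N \<Longrightarrow> x \<in> range (P {\<omega>}) \<Longrightarrow> U x = u \<omega> x"
    using unitary_glue[OF S.atomic_resolution[OF assms(1)] S'.atomic_resolution[OF assms(2)] u] by blast
  have bounded_U: "bounded_clinear U"
    by (rule unitary_between_UNIV_bounded_clinear[OF U])
  have "U (S i x) = S' i (U x)" if i: "i < N" for i x
  proof (rule has_sum_unique)
    have atoms: "((\<lambda>\<omega>. P {\<omega>} x) has_sum x) (inf_words N)"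
      using resolutionD(5)[OF S.atomic_resolution[OF assms(1)]] by simp
    have "((\<lambda>\<omega>. (U \<circ> S i) (P {\<omega>} x)) has_sum (U \<circ> S i) x) (inf_words N)"
      by (rule has_sum_bounded_linear[OF _ atoms])
         (intro bounded_clinear_bounded_linear bounded_clinear_compose bounded_U S.generator_bounded i)
    then show "((\<lambda>\<omega>. U (S i (P {\<omega>} x))) has_sum U (S i x)) (inf_words N)"
      by simp
    have "((\<lambda>\<omega>. (S' i \<circ> U) (P {\<omega>} x)) has_sum (S' i \<circ> U) x) (inf_words N)"
      by (rule has_sum_bounded_linear[OF _ atoms])
         (intro bounded_clinear_bounded_linear bounded_clinear_compose bounded_U S'.generator_bounded i)
    moreover have "S' i (U (P {\<omega>} x)) = U (S i (P {\<omega>} x))" if \<omega>: "\<omega> \<in> inf_words N" for \<omega>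
    proof -
      have "S i (P {\<omega>} x) \<in> range (P {i ## \<omega>})"
        unfolding S.generator_atom[OF i \<omega>, symmetric] by (rule rangeI)
      then have "U (S i (P {\<omega>} x)) = u (i ## \<omega>) (S i (P {\<omega>} x))"
        by (rule Uu[rotated]) (simp add: i \<omega>)
      also have "\<dots> = S' i (u \<omega> (P {\<omega>} x))"
        by (rule u_gen[OF \<omega> i rangeI])
      also have "u \<omega> (P {\<omega>} x) = U (P {\<omega>} x)"
        by (rule Uu[OF \<omega> rangeI, symmetric])
      finally show ?thesis ..
    qed
    ultimately show "((\<lambda>\<omega>. U (S i (P {\<omega>} x))) has_sum S' i (U x)) (inf_words N)"
      unfolding comp_apply by (simp cong: has_sum_cong)
  qed
  then show ?thesis
    using U unfolding unitarily_equivalent_def by (auto simp: fun_eq_iff)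
qed

end

theorem corollary4p8:
  fixes N :: nat
    and S :: "nat \<Rightarrow> 'a::chilbert_space \<Rightarrow> 'a"
    and S' :: "nat \<Rightarrow> 'b::chilbert_space \<Rightarrow> 'b"
    and P :: "(nat \<Rightarrow> nat) set \<Rightarrow> 'a \<Rightarrow> 'a"
    and P' :: "(nat \<Rightarrow> nat) set \<Rightarrow> 'b \<Rightarrow> 'b"
  assumes "N \<ge> 2"
    and "cuntz_rep N S" and "cuntz_rep N S'"
    and "associated_pvm N S P" and "associated_pvm N S' P'"
    and "purely_atomic N P" and "purely_atomic N P'"
  shows "unitarily_equivalent N S S' \<longleftrightarrow>
    atomic_support N P = atomic_support N P' \<and>
    (\<forall>\<omega>\<in>atomic_support N P. same_hilbert_dim (range (P {\<omega>})) (range (P' {\<omega>}))) \<and>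
    (\<forall>\<omega>\<in>atomic_support N P. is_cycle \<omega> \<longrightarrow>
       (\<forall>I. I \<noteq> [] \<and> \<omega> = I\<^sup>\<omega> \<longrightarrow>
          (\<exists>U. unitary_between (range (P {\<omega>})) (range (P' {\<omega>})) U \<and>
               (\<forall>x\<in>range (P {\<omega>}). U (word_op S I x) = word_op S' I (U x)))))"
proof -
  interpret cuntz_measure_pair N S P S' P'
    by unfold_locales (fact assms)+
  show ?thesis
  proof (rule iffI; (elim conjE)?)
    assume "unitarily_equivalent N S S'"
    then obtain U where U: "unitary_between UNIV UNIV U" and "\<forall>i<N. U \<circ> S i = S' i \<circ> U"
      unfolding unitarily_equivalent_def by blast
    then have gen: "U (S i x) = S' i (U x)" if "i < N" for i x
      using that by (metis comp_apply)
    have atom: "atom_unitary \<omega> U" if "\<omega> \<in> atomic_support N P" for \<omega>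
      by (rule equivalence_atom_unitary[OF U gen]) (use that in \<open>auto simp: atomic_support_def\<close>)
    show "atomic_support N P = atomic_support N P' \<and>
      (\<forall>\<omega>\<in>atomic_support N P. same_hilbert_dim (range (P {\<omega>})) (range (P' {\<omega>}))) \<and>
      (\<forall>\<omega>\<in>atomic_support N P. is_cycle \<omega> \<longrightarrow>
         (\<forall>I. I \<noteq> [] \<and> \<omega> = I\<^sup>\<omega> \<longrightarrow>
            (\<exists>U. unitary_between (range (P {\<omega>})) (range (P' {\<omega>})) U \<and>
                 (\<forall>x\<in>range (P {\<omega>}). U (word_op S I x) = word_op S' I (U x)))))"
    proof (intro conjI ballI impI allI)
      show "atomic_support N P = atomic_support N P'"
        by (rule equivalence_atomic_support[OF U gen])
      fix \<omega> assume \<omega>: "\<omega> \<in> atomic_support N P"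
      then have \<omega>N: "\<omega> \<in> inf_words N"
        by (simp add: atomic_support_def)
      show "same_hilbert_dim (range (P {\<omega>})) (range (P' {\<omega>}))"
        using atom[OF \<omega>] same_hilbert_dim_iff_unitary S.closed_csubspace_atom[OF \<omega>N]
          S'.closed_csubspace_atom[OF \<omega>N] by blast
      fix I assume I: "I \<noteq> [] \<and> \<omega> = I\<^sup>\<omega>"
      then have "I \<frown> \<omega> = \<omega>"
        using iter_unroll[of I] by simp
      with \<omega>N have "set I \<subseteq> {..<N}"
        by (metis inf_words_conc)
      with atom[OF \<omega>] show "\<exists>U. unitary_between (range (P {\<omega>})) (range (P' {\<omega>})) U \<and>
          (\<forall>x\<in>range (P {\<omega>}). U (word_op S I x) = word_op S' I (U x))"
        using equivalence_word[OF gen] by blast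
    qed
  next
    assume supp: "atomic_support N P = atomic_support N P'"
      and dim: "\<forall>\<omega>\<in>atomic_support N P. same_hilbert_dim (range (P {\<omega>})) (range (P' {\<omega>}))"
      and cyc: "\<forall>\<omega>\<in>atomic_support N P. is_cycle \<omega> \<longrightarrow>
         (\<forall>I. I \<noteq> [] \<and> \<omega> = I\<^sup>\<omega> \<longrightarrow>
            (\<exists>U. unitary_between (range (P {\<omega>})) (range (P' {\<omega>})) U \<and>
                 (\<forall>x\<in>range (P {\<omega>}). U (word_op S I x) = word_op S' I (U x))))"
    show "unitarily_equivalent N S S'"
    proof (rule equivalence_from_atoms[OF assms(6,7)])
      fix \<omega> assume \<omega>: "\<omega> \<in> inf_words N"
      show "\<exists>V. atom_unitary \<omega> V \<and> (is_cycle \<omega> \<longrightarrow> intertwines \<omega> (prefix (period \<omega>) \<omega>) V)"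
      proof (cases "\<omega> \<in> atomic_support N P")
        \<comment> \<open>Both atoms are zero, and the zero map is unitary between them.\<close>
        case False
        moreover have "\<omega> \<notin> atomic_support N P'"
          using False supp by simp
        ultimately have "P {\<omega>} = (\<lambda>_. 0)" "P' {\<omega>} = (\<lambda>_. 0)"
          using \<omega> by (auto simp: atomic_support_def)
        then have "atom_unitary \<omega> (\<lambda>_. 0)" "intertwines \<omega> (prefix (period \<omega>) \<omega>) (\<lambda>_. 0)"
          using bounded_clinear_zero[OF S'.word_op_bounded[OF set_prefix_inf_words[OF \<omega>]]]
          by (auto simp: unitary_between_def intertwines_def)
        then show ?thesis
          by blast
      next
        case True
        show ?thesis
        proof (cases "is_cycle \<omega>")
          case cycle: True
          have "prefix (period \<omega>) \<omega> \<noteq> []"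
            by (simp add: period_def)
          moreover have "\<omega> = (prefix (period \<omega>) \<omega>)\<^sup>\<omega>"
            by (rule suffix_period_iter[OF suffix_period[OF cycle]]) (simp add: period_def)
          ultimately show ?thesis
            using cyc True cycle unfolding intertwines_def by blast
        next
          case False
          have "\<exists>V. atom_unitary \<omega> V"
            using dim True same_hilbert_dim_iff_unitary S.closed_csubspace_atom[OF \<omega>]
              S'.closed_csubspace_atom[OF \<omega>] by blast
          with False show ?thesis
            by blast
        qed
      qed
    qed
  qed
qed

end
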